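(* Let $n \geq 3$ and let $G$ be a group. If $G$ has no subgroup isomorphic to the symmetric group $S_{n+1}$, then the image of every homomorphism $\mathrm{Aut}(F_n) \to G$ has cardinality at most $2$.
   Context: $F_n$ denotes the free group of rank $n$ and $\mathrm{Aut}(F_n)$ its automorphism group. $S_{n+1}$ is the symmetric group on $n+1$ letters. *)

theory Defs
  imports "HOL-Algebra.Bij" "HOL-Algebra.Sym_Groups"
begin

text \<open>
  The free group of rank \<open>n\<close>, realised as the group of reduced words in the generators
  \<open>0, \<dots>, n - 1\<close> and their formal inverses: the letter \<open>(i, True)\<close> stands for the \<open>i\<close>-th generator,
  \<open>(i, False)\<close> for its inverse. That this is indeed a free group on these generators is shown in
  \<open>free_group_is_group\<close> and \<open>free_group_universal\<close>.
\<close>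

type_synonym letter = "nat \<times> bool"

definition letter_inv :: "letter \<Rightarrow> letter" where
  "letter_inv x = (fst x, \<not> snd x)"

definition reduced :: "letter list \<Rightarrow> bool" where
  "reduced w \<longleftrightarrow> successively (\<lambda>x y. y \<noteq> letter_inv x) w"

text \<open>\<open>push x w\<close> is the reduced form of \<open>x # w\<close> for a reduced word \<open>w\<close>.\<close>

fun push :: "letter \<Rightarrow> letter list \<Rightarrow> letter list" where
  "push x [] = [x]"
| "push x (y # w) = (if y = letter_inv x then w else x # y # w)"

definition reduce :: "letter list \<Rightarrow> letter list" where
  "reduce w = foldr push w []"

definition free_group :: "nat \<Rightarrow> letter list monoid" where
  "free_group n =
     \<lparr>carrier = {w. reduced w \<and> fst ` set w \<subseteq> {..<n}},
      monoid.mult = (\<lambda>u v. reduce (u @ v)),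
      one = []\<rparr>"

definition free_gen :: "nat \<Rightarrow> letter list" where
  "free_gen i = [(i, True)]"

lemma letter_inv_letter_inv [simp]: "letter_inv (letter_inv x) = x"
  by (simp add: letter_inv_def)

lemma fst_letter_inv [simp]: "fst (letter_inv x) = fst x"
  by (simp add: letter_inv_def)

lemma letter_inv_neq [simp]: "letter_inv x \<noteq> x" "x \<noteq> letter_inv x"
  by (auto simp: letter_inv_def prod_eq_iff)

lemma reduced_Nil [simp]: "reduced []"
  and reduced_Single [simp]: "reduced [x]"
  and reduced_Cons_Cons [simp]:
    "reduced (x # y # w) \<longleftrightarrow> y \<noteq> letter_inv x \<and> reduced (y # w)"
  by (auto simp: reduced_def)

lemma reduced_ConsD: "reduced (x # w) \<Longrightarrow> reduced w"
  by (cases w) auto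

lemma reduced_push: "reduced w \<Longrightarrow> reduced (push x w)"
  by (cases w) (auto dest: reduced_ConsD)

lemma push_eq_Cons: "reduced (x # w) \<Longrightarrow> push x w = x # w"
  by (cases w) auto

lemma push_push_letter_inv: "reduced w \<Longrightarrow> push x (push (letter_inv x) w) = w"
  by (cases w) (auto simp: push_eq_Cons)

lemma set_push: "set (push x w) \<subseteq> insert x (set w)"
  by (cases w) auto

lemma reduced_foldr_push: "reduced w \<Longrightarrow> reduced (foldr push u w)"
  by (induction u) (auto intro: reduced_push)

lemma set_foldr_push: "set (foldr push u w) \<subseteq> set u \<union> set w"
  by (induction u) (use set_push in fastforce)+

lemma reduced_reduce [simp]: "reduced (reduce w)"
  by (simp add: reduce_def reduced_foldr_push)

lemma set_reduce: "set (reduce w) \<subseteq> set w"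
  using set_foldr_push[of w "[]"] by (simp add: reduce_def)

lemma reduce_reduced [simp]: "reduced w \<Longrightarrow> reduce w = w"
  by (induction w) (use reduced_ConsD push_eq_Cons in \<open>fastforce simp: reduce_def\<close>)+

lemma reduce_append: "reduced v \<Longrightarrow> reduce (u @ v) = foldr push u v"
  using reduce_reduced[of v] by (simp add: reduce_def)

lemma foldr_push_push:
  assumes "reduced w"
  shows "foldr push (push x u) w = push x (foldr push u w)"
proof (cases u)
  case (Cons y us)
  show ?thesis
  proof (cases "y = letter_inv x")
    case True
    then show ?thesis
      using Cons push_push_letter_inv[OF reduced_foldr_push[OF assms], of x us] by simp
  qed (use Cons in auto)
qed auto

lemma foldr_push_foldr_push:
  assumes "reduced w"
  shows "foldr push (foldr push u v) w = foldr push u (foldr push v w)"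
  by (induction u) (simp_all add: foldr_push_push[OF assms])

lemma foldr_push_inverse: "foldr push (rev (map letter_inv w)) w = []"
proof (induction w)
  case (Cons x w)
  then show ?case by simp
qed simp

lemma reduced_rev_letter_inv:
  assumes "reduced w"
  shows "reduced (rev (map letter_inv w))"
proof -
  have "successively (\<lambda>y x. letter_inv y \<noteq> letter_inv (letter_inv x)) w"
    using assms unfolding reduced_def
    by (rule successively_mono) (metis letter_inv_letter_inv)
  then show ?thesis
    by (simp add: reduced_def successively_map)
qed

theorem free_group_is_group: "group (free_group n)"
proof (rule groupI)
  fix u v assume "u \<in> carrier (free_group n)" "v \<in> carrier (free_group n)"
  then show "u \<otimes>\<^bsub>free_group n\<^esub> v \<in> carrier (free_group n)"
    using set_reduce[of "u @ v"] by (fastforce simp: free_group_def)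
next
  fix u v w
  assume "u \<in> carrier (free_group n)" "v \<in> carrier (free_group n)" "w \<in> carrier (free_group n)"
  then show "u \<otimes>\<^bsub>free_group n\<^esub> v \<otimes>\<^bsub>free_group n\<^esub> w
      = u \<otimes>\<^bsub>free_group n\<^esub> (v \<otimes>\<^bsub>free_group n\<^esub> w)"
    by (simp add: free_group_def reduce_append reduced_foldr_push foldr_push_foldr_push)
next
  fix w assume w: "w \<in> carrier (free_group n)"
  have "rev (map letter_inv w) \<in> carrier (free_group n)"
    using w by (auto simp: free_group_def reduced_rev_letter_inv)
  moreover have "rev (map letter_inv w) \<otimes>\<^bsub>free_group n\<^esub> w = \<one>\<^bsub>free_group n\<^esub>"
    using w by (simp add: free_group_def reduce_append foldr_push_inverse)
  ultimately show "\<exists>v\<in>carrier (free_group n). v \<otimes>\<^bsub>free_group n\<^esub> w = \<one>\<^bsub>free_group n\<^esub>"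
    by blast
qed (simp_all add: free_group_def)

lemma free_gen_closed: "i < n \<Longrightarrow> free_gen i \<in> carrier (free_group n)"
  by (simp add: free_gen_def free_group_def)

lemma inv_free_gen: "i < n \<Longrightarrow> inv\<^bsub>free_group n\<^esub> (free_gen i) = [(i, False)]"
  by (rule group.inv_equality[OF free_group_is_group])
     (simp_all add: free_gen_def free_group_def reduce_def letter_inv_def)

lemma free_group_induct [consumes 1, case_names one gen_mult inv_mult]:
  assumes "w \<in> carrier (free_group n)"
    and "P \<one>\<^bsub>free_group n\<^esub>"
    and "\<And>i w. \<lbrakk>i < n; w \<in> carrier (free_group n); P w\<rbrakk>
           \<Longrightarrow> P (free_gen i \<otimes>\<^bsub>free_group n\<^esub> w)"
    and "\<And>i w. \<lbrakk>i < n; w \<in> carrier (free_group n); P w\<rbrakk>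
           \<Longrightarrow> P (inv\<^bsub>free_group n\<^esub> (free_gen i) \<otimes>\<^bsub>free_group n\<^esub> w)"
  shows "P w"
  using assms(1)
proof (induction w)
  case Nil
  then show ?case using assms(2) by (simp add: free_group_def)
next
  case (Cons x w)
  obtain i b where x: "x = (i, b)" by force
  have i: "i < n" and w: "w \<in> carrier (free_group n)" and red: "reduced (x # w)"
    using Cons.prems x by (auto simp: free_group_def dest: reduced_ConsD)
  have "x # w = [x] \<otimes>\<^bsub>free_group n\<^esub> w"
    using red by (simp add: free_group_def)
  then show ?case
    using assms(3,4)[OF i w Cons.IH[OF w]] x inv_free_gen[OF i]
    by (cases b) (auto simp: free_gen_def)
qed

theorem free_group_universal:
  assumes "group G" and f: "\<And>i. i < n \<Longrightarrow> f i \<in> carrier G"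
  shows "\<exists>h \<in> hom (free_group n) G. (\<forall>i<n. h (free_gen i) = f i) \<and>
           (\<forall>h' \<in> hom (free_group n) G. (\<forall>i<n. h' (free_gen i) = f i) \<longrightarrow>
              (\<forall>w \<in> carrier (free_group n). h' w = h w))"
proof -
  interpret G: group G by fact
  define l where "l x = (if snd x then f (fst x) else inv\<^bsub>G\<^esub> f (fst x))" for x :: letter
  define h where "h w = foldr (\<lambda>x g. l x \<otimes>\<^bsub>G\<^esub> g) w \<one>\<^bsub>G\<^esub>" for w
  have l_closed: "l x \<in> carrier G" if "fst x < n" for x
    using f[OF that] by (simp add: l_def)
  have l_inv: "l x \<otimes>\<^bsub>G\<^esub> l (letter_inv x) = \<one>\<^bsub>G\<^esub>" if "fst x < n" for x
    using f[OF that] by (simp add: l_def letter_inv_def)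
  have h_closed: "h w \<in> carrier G" if "fst ` set w \<subseteq> {..<n}" for w
    using that by (induction w) (auto simp: h_def intro: l_closed)
  have h_push: "h (push x w) = l x \<otimes>\<^bsub>G\<^esub> h w" if x: "fst x < n" and w: "fst ` set w \<subseteq> {..<n}" for x w
  proof (cases w)
    case (Cons y v)
    have v: "h v \<in> carrier G" using w Cons by (intro h_closed) auto
    show ?thesis
    proof (cases "y = letter_inv x")
      case True
      then have "l x \<otimes>\<^bsub>G\<^esub> h w = (l x \<otimes>\<^bsub>G\<^esub> l (letter_inv x)) \<otimes>\<^bsub>G\<^esub> h v"
        using Cons x v by (simp add: h_def G.m_assoc l_closed)
      also have "\<dots> = h (push x w)" using True Cons v by (simp add: l_inv[OF x])
      finally show ?thesis by simp
    qed (simp add: Cons h_def)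
  qed (simp add: h_def)
  have h_foldr: "h (foldr push u w) = h u \<otimes>\<^bsub>G\<^esub> h w"
    if "fst ` set u \<subseteq> {..<n}" and w: "fst ` set w \<subseteq> {..<n}" for u w
    using that(1)
  proof (induction u)
    case Nil
    then show ?case using h_closed[OF w] by (simp add: h_def)
  next
    case (Cons x u)
    have "fst ` set (foldr push u w) \<subseteq> {..<n}"
      using set_foldr_push[of u w] Cons.prems w by fastforce
    moreover have "h (x # u) = l x \<otimes>\<^bsub>G\<^esub> h u" by (simp add: h_def)
    ultimately show ?case
      using Cons h_closed[OF w] h_closed[of u] by (simp add: h_push l_closed G.m_assoc)
  qed
  have hom: "h \<in> hom (free_group n) G"
    by (rule homI) (auto simp: free_group_def reduce_append h_foldr h_closed)
  have gen: "\<forall>i<n. h (free_gen i) = f i"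
    using f by (simp add: h_def l_def free_gen_def)
  have "h' w = h w"
    if h': "h' \<in> hom (free_group n) G" "\<forall>i<n. h' (free_gen i) = f i"
      and w: "w \<in> carrier (free_group n)" for h' w
  proof -
    interpret F: group "free_group n" by (rule free_group_is_group)
    interpret h: group_hom "free_group n" G h by unfold_locales (rule hom)
    interpret h': group_hom "free_group n" G h' by unfold_locales (rule h')
    show ?thesis
      using w by (induction rule: free_group_induct) (auto simp: free_gen_closed gen h'(2))
  qed
  with hom gen show ?thesis by blast
qed

end

theory Submission
  imports Defs "HOL-Library.Sublist"
begin

text \<open>
  The symmetric group on \<open>n + 1\<close> letters acts faithfully on the free group by permuting the edges
  of a graph with two vertices and \<open>n + 1\<close> parallel edges. If a homomorphism from the automorphism
  group is not injective on it, then its kernel contains a nontrivial normal subgroup of the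
  symmetric group, hence (as \<open>n + 1 \<ge> 4\<close>) all double transpositions. Multiplying one of them with a
  conjugate by a transvection yields \<open>x\<^sub>i \<mapsto> x\<^sub>i x\<^sub>k, x\<^sub>j \<mapsto> x\<^sub>j x\<^sub>k\<close> in the kernel. With the
  commutator relation of transvections this forces all transvections into the kernel, and modulo
  transvections all inversions \<open>x\<^sub>i \<mapsto> x\<^sub>i\<^sup>-\<^sup>1\<close> agree. Since transvections and inversions generate the
  automorphism group by Nielsen's theorem, the image has at most two elements.
\<close>

section \<open>Reduced words\<close>

definition word_inv :: "letter list \<Rightarrow> letter list" where
  "word_inv w = rev (map letter_inv w)"

lemma word_inv_simps [simp]:
  "word_inv [] = []"
  "word_inv (u @ v) = word_inv v @ word_inv u"
  "word_inv (word_inv w) = w"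
  "length (word_inv w) = length w"
  "fst ` set (word_inv w) = fst ` set w"
  "word_inv w = [] \<longleftrightarrow> w = []"
  by (auto simp: word_inv_def rev_map image_image comp_def)

lemma word_inv_Cons: "word_inv (x # w) = word_inv w @ [letter_inv x]"
  by (simp add: word_inv_def)

lemma reduced_word_inv [simp]: "reduced (word_inv w) \<longleftrightarrow> reduced w"
  using reduced_rev_letter_inv[of w] reduced_rev_letter_inv[of "word_inv w"]
  by (metis word_inv_def word_inv_simps(3))

lemma reduced_append_iff:
  "reduced (u @ v) \<longleftrightarrow>
     reduced u \<and> reduced v \<and> (u = [] \<or> v = [] \<or> hd v \<noteq> letter_inv (last u))"
  by (auto simp: reduced_def successively_append_iff)

lemma reduce_append_foldr: "reduce (u @ v) = foldr push u (reduce v)"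
  by (simp add: reduce_def)

lemma reduce_append_reduce: "reduce (reduce u @ reduce v) = reduce (u @ v)"
  using foldr_push_foldr_push[OF reduced_reduce, of u "[]" v]
  by (simp add: reduce_append) (simp add: reduce_def)

lemma foldr_push_word_inv:
  "reduced w \<Longrightarrow> foldr push (word_inv p) (foldr push p w) = w"
proof (induction p)
  case (Cons x p)
  have "push (letter_inv x) (push x (foldr push p w)) = foldr push p w"
    using push_push_letter_inv[of "foldr push p w" "letter_inv x"] Cons.prems
    by (simp add: reduced_foldr_push)
  with Cons show ?case by (simp add: word_inv_Cons)
qed simp

lemma reduce_cancel: "reduce (u @ word_inv p @ p @ v) = reduce (u @ v)"
  by (simp add: reduce_append_foldr foldr_push_word_inv)

text \<open>A push adds at most one letter, so a loss of length in the tail is never made up; onto a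
  reduced tail it either prepends a letter or cancels two.\<close>

lemma reduce_cases: "reduced w \<or> length (reduce w) < length w"
proof (induction w)
  case (Cons x w)
  have len: "length (push x v) \<le> Suc (length v)" for v
    by (cases v) auto
  have step: "reduce (x # w) = push x (reduce w)"
    by (simp add: reduce_def)
  show ?case
  proof (cases "reduced w")
    case True
    then show ?thesis using step by (cases w) auto
  next
    case False
    with Cons have "length (reduce w) < length w" by simp
    with len[of "reduce w"] step show ?thesis by simp
  qed
qed simp

lemma length_reduce_le: "length (reduce w) \<le> length w"
  using reduce_cases[of w] by auto

lemma common_prefix_exhaust:
  obtains p u' v' where "u = p @ u'" "v = p @ v'" "u' = [] \<or> v' = [] \<or> hd u' \<noteq> hd v'"
proof -
  have "\<exists>p u' v'. u = p @ u' \<and> v = p @ v' \<and> (u' = [] \<or> v' = [] \<or> hd u' \<noteq> hd v')"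
  proof (induction u arbitrary: v)
    case (Cons x u)
    show ?case
    proof (cases v)
      case (Cons y v')
      show ?thesis
      proof (cases "x = y")
        case True
        obtain p a b where "u = p @ a" "v' = p @ b" "a = [] \<or> b = [] \<or> hd a \<noteq> hd b"
          using Cons.IH[of v'] by blast
        then show ?thesis
          using \<open>v = y # v'\<close> True by (intro exI[of _ "x # p"] exI[of _ a] exI[of _ b]) auto
      next
        case False
        then show ?thesis
          using \<open>v = y # v'\<close>
          by (intro exI[of _ "[]"] exI[of _ "x # u"] exI[of _ v]) simp
      qed
    qed auto
  qed auto
  with that show thesis by blast
qed

text \<open>A common prefix reaching the middle would pair letters of \<open>w\<close> symmetrically
  as inverses: in odd length the middle letter would be its own inverse, in even length the two
  middle letters would cancel.\<close>

lemma common_prefix_word_inv: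
  assumes "reduced w" "w \<noteq> []" "prefix p w" "prefix p (word_inv w)"
  shows "2 * length p < length w"
proof (rule ccontr)
  assume "\<not> ?thesis"
  then have long: "length w \<le> 2 * length p" by simp
  have sym: "w ! i = letter_inv (w ! (length w - Suc i))" if "i < length p" for i
  proof -
    have "i < length w" using that assms(3) prefix_length_le by fastforce
    moreover have "w ! i = word_inv w ! i"
      using assms(3,4) that by (auto simp: prefix_def nth_append)
    ultimately show ?thesis
      by (simp add: word_inv_def rev_nth)
  qed
  consider k where "length w = 2 * k + 1" | k where "length w = 2 * Suc k"
    using assms(2) by (metis Suc_eq_plus1 evenE length_0_conv mult_0_right oddE old.nat.exhaust)
  then show False
  proof cases
    case (1 k)
    have *: "length w - Suc k = k" using 1 by simp
    have "w ! k = letter_inv (w ! k)" using sym[of k] long 1 unfolding * by simp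
    then show False by (metis letter_inv_neq(1))
  next
    case (2 k)
    have *: "length w - Suc k = Suc k" using 2 by simp
    have "w ! k = letter_inv (w ! Suc k)" using sym[of k] long 2 unfolding * by simp
    then have "w ! Suc k = letter_inv (w ! k)" by simp
    moreover have "Suc k < length w" using 2 by simp
    ultimately show False
      using assms(1) by (auto simp: reduced_def successively_conv_nth)
  qed
qed

section \<open>Codes and weights of words\<close>

text \<open>The letters are read as nonzero digits in base \<open>2 * n + 1\<close>. A longer word thus has a
  larger code, and among words of equal length the leading letters dominate.\<close>

primrec word_code :: "nat \<Rightarrow> letter list \<Rightarrow> nat" where
  "word_code B [] = 0"
| "word_code B (x # w) = (2 * fst x + (if snd x then 1 else 2)) * B ^ length w + word_code B w"

lemma word_code_append: "word_code B (u @ v) = word_code B u * B ^ length v + word_code B v"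
  by (induction u) (auto simp: algebra_simps power_add)

lemma word_code_less:
  assumes "fst ` set w \<subseteq> {..<n}"
  shows "word_code (2 * n + 1) w < (2 * n + 1) ^ length w"
  using assms
proof (induction w)
  case (Cons x w)
  let ?B = "2 * n + 1"
  have "2 * fst x + (if snd x then 1 else 2) + 1 \<le> ?B" using Cons.prems by auto
  then have "(2 * fst x + (if snd x then 1 else 2) + 1) * ?B ^ length w \<le> ?B * ?B ^ length w"
    by (rule mult_right_mono) simp
  moreover have "word_code ?B w < ?B ^ length w" using Cons by simp
  ultimately show ?case by (simp add: algebra_simps)
qed simp

lemma word_code_ge: "w \<noteq> [] \<Longrightarrow> B ^ (length w - 1) \<le> word_code B w"
  by (cases w) auto

lemma word_code_inject:
  assumes "length u = length v" "fst ` set u \<subseteq> {..<n}" "fst ` set v \<subseteq> {..<n}"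
    and "word_code (2 * n + 1) u = word_code (2 * n + 1) v"
  shows "u = v"
  using assms
proof (induction u v rule: list_induct2)
  case (Cons x u y v)
  let ?B = "2 * n + 1"
  let ?d = "\<lambda>x::letter. 2 * fst x + (if snd x then 1 else 2 :: nat)"
  have u: "word_code ?B u < ?B ^ length u" and v: "word_code ?B v < ?B ^ length u"
    using Cons.prems word_code_less[of u n] word_code_less[of v n] Cons.hyps by auto
  have eq: "?d x * ?B ^ length u + word_code ?B u = ?d y * ?B ^ length u + word_code ?B v"
    using Cons.prems Cons.hyps by simp
  \<comment> \<open>Both tails have codes below the place value, so division recovers the leading
    digits.\<close>
  have "(?d x * ?B ^ length u + word_code ?B u) div ?B ^ length u = ?d x"
    "(?d y * ?B ^ length u + word_code ?B v) div ?B ^ length u = ?d y"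
    using u v by simp_all
  with eq have d: "?d x = ?d y" by simp
  then have "x = y"
    by (cases x; cases y) (auto split: if_splits; presburger)
  moreover have "word_code ?B u = word_code ?B v" using eq d by simp
  ultimately show ?case using Cons by auto
qed simp

text \<open>Symmetric under inversion; refines the length by a tie-break that decides which of two
  half-cancelling words gets replaced in Nielsen's reduction.\<close>

definition word_weight :: "nat \<Rightarrow> letter list \<Rightarrow> nat" where
  "word_weight n w = word_code (2 * n + 1) w + word_code (2 * n + 1) (word_inv w)"

lemma word_weight_word_inv [simp]: "word_weight n (word_inv w) = word_weight n w"
  by (simp add: word_weight_def)

lemma word_weight_shorter:
  assumes "length u < length v" "fst ` set u \<subseteq> {..<n}"
  shows "word_weight n u < word_weight n v"
proof -
  have *: "word_code (2 * n + 1) a < word_code (2 * n + 1) b"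
    if "length a < length b" "fst ` set a \<subseteq> {..<n}" for a b :: "letter list"
  proof -
    have "word_code (2 * n + 1) a < (2 * n + 1) ^ length a" by (rule word_code_less) fact
    also have "\<dots> \<le> (2 * n + 1) ^ (length b - 1)"
      using that(1) by (intro power_increasing) auto
    also have "\<dots> \<le> word_code (2 * n + 1) b" using that(1) by (intro word_code_ge) auto
    finally show ?thesis .
  qed
  show ?thesis
    unfolding word_weight_def using assms by (intro add_strict_mono *) auto
qed

text \<open>Going from \<open>q\<close> to \<open>p\<close> lowers the code by at least
  \<open>(2 * n + 1) ^ length w\<close>, while the inverse words differ only in their last
  \<open>length p\<close> letters, worth less than \<open>(2 * n + 1) ^ length p\<close>. As the
  prefix is no longer than \<open>w\<close>, the drop wins.\<close>

lemma word_weight_prefix: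
  assumes "length p = length q" "length q \<le> length w" "fst ` set p \<subseteq> {..<n}"
    and "word_code (2 * n + 1) p < word_code (2 * n + 1) q"
  shows "word_weight n (p @ w) < word_weight n (q @ w)"
proof -
  let ?c = "word_code (2 * n + 1)" and ?B = "2 * n + 1"
  have "?c (word_inv p) < ?B ^ length p"
    using word_code_less[of "word_inv p" n] assms(3) by simp
  also have "\<dots> \<le> ?B ^ length w"
    using assms(1,2) by (intro power_increasing) auto
  finally have "?c (word_inv p) < ?B ^ length w" .
  moreover have "(?c p + 1) * ?B ^ length w \<le> ?c q * ?B ^ length w"
    using assms(4) by (intro mult_right_mono) auto
  ultimately have "?c p * ?B ^ length w + ?c (word_inv p) < ?c q * ?B ^ length w + ?c (word_inv q)"
    by (simp add: algebra_simps)
  then show ?thesis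
    using assms(1) by (simp add: word_weight_def word_code_append)
qed

lemma word_weight_reduce_le:
  assumes "fst ` set w \<subseteq> {..<n}"
  shows "word_weight n (reduce w) \<le> word_weight n w"
proof (cases "reduced w")
  case False
  then have "length (reduce w) < length w" using reduce_cases by blast
  moreover have "fst ` set (reduce w) \<subseteq> {..<n}" using set_reduce[of w] assms by fastforce
  ultimately show ?thesis using word_weight_shorter by (simp add: less_imp_le)
qed simp

section \<open>Nielsen reduction\<close>

text \<open>Indexing by signed generators puts the images of generators and of their inverses into
  one family closed under inversion.\<close>

locale letter_images =
  fixes n :: nat and y :: "letter \<Rightarrow> letter list"
  assumes reduced_y: "fst l < n \<Longrightarrow> reduced (y l)"
    and y_nonempty: "fst l < n \<Longrightarrow> y l \<noteq> []"
    and y_letters: "fst l < n \<Longrightarrow> fst ` set (y l) \<subseteq> {..<n}"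
    and y_inv: "y (letter_inv l) = word_inv (y l)"

text \<open>Nielsen's conditions in one axiom. In a reduced word, a left neighbour
  \<open>letter_inv l'\<close> of \<open>l\<close> can cancel only a common prefix of
  \<open>y l\<close> and \<open>y l'\<close>, a right neighbour \<open>l''\<close> only one of
  \<open>y (letter_inv l)\<close> and \<open>y l''\<close>; some letter of \<open>y l\<close>
  survives both.\<close>

locale nielsen_reduced = letter_images +
  assumes cancel_less:
    "\<lbrakk>fst l < n; fst l' < n; fst l'' < n; l' \<noteq> l; l'' \<noteq> letter_inv l;
      prefix p (y l); prefix p (y l'); prefix q (y (letter_inv l)); prefix q (y l'')\<rbrakk>
     \<Longrightarrow> length p + length q < length (y l)"
begin

text \<open>The image of \<open>l\<close> is \<open>s @ t\<close>, where \<open>t\<close> is what has been cancelled by the images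
  of the letters of \<open>w\<close>; what remains of each image is nonempty.\<close>

lemma reduce_concat_Cons:
  assumes "reduced (l # w)" "fst ` set (l # w) \<subseteq> {..<n}"
  shows "\<exists>s t R l''. y l = s @ t \<and> reduce (concat (map y (l # w))) = s @ R \<and> length w \<le> length R
           \<and> fst l'' < n \<and> l'' \<noteq> letter_inv l \<and> prefix (word_inv t) (y l'')"
  using assms
proof (induction w arbitrary: l)
  case Nil
  then show ?case
    by (intro exI[of _ "y l"] exI[of _ "[]"] exI[of _ l]) (auto simp: reduced_y)
next
  case (Cons m w l)
  have l: "fst l < n" and m: "fst m < n" and ml: "m \<noteq> letter_inv l"
    using Cons.prems by auto
  obtain s t R m'' where st: "y m = s @ t" and red: "reduce (concat (map y (m # w))) = s @ R"
    and R: "length w \<le> length R"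
    and m'': "fst m'' < n" "m'' \<noteq> letter_inv m" "prefix (word_inv t) (y m'')"
    using Cons.IH[of m] Cons.prems by auto
  \<comment> \<open>\<open>p\<close> is exactly what cancels between the images of \<open>l\<close>
    and \<open>m\<close>.\<close>
  obtain p z' s'' where z: "y (letter_inv l) = p @ z'" and ym: "y m = p @ s''"
    and branch: "z' = [] \<or> s'' = [] \<or> hd z' \<noteq> hd s''"
    by (rule common_prefix_exhaust)
  \<comment> \<open>The left neighbour of \<open>m\<close> is \<open>l\<close>, so
    \<open>letter_inv l\<close> plays the role of \<open>l'\<close>. Thus \<open>p\<close> ends
    before the part \<open>t\<close> of \<open>y m\<close> that is lost on the right.\<close>
  have "length p + length (word_inv t) < length (y m)"
  proof (rule cancel_less[of m "letter_inv l" m''])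
    show "prefix (word_inv t) (y (letter_inv m))"
      using st by (simp add: y_inv)
  qed (use l m ml m'' ym z in auto)
  then have "length p < length s" using st by simp
  then obtain s' where s: "s = p @ s'" and s': "s' \<noteq> []" "s'' = s' @ t"
    using st ym by (auto simp: append_eq_append_conv2)
  have yl: "y l = word_inv z' @ word_inv p"
    using z y_inv[of "letter_inv l"] by simp
  \<comment> \<open>Maximality of \<open>p\<close> prevents cancellation where
    \<open>word_inv z'\<close> meets the nonempty \<open>s'\<close>.\<close>
  have "reduced (word_inv z' @ s' @ R)"
  proof -
    have "reduced (s @ R)" using red by (metis reduced_reduce)
    then have "reduced (s' @ R)" by (simp add: s reduced_append_iff)
    moreover have "reduced (word_inv z')" using reduced_y[OF l] yl by (simp add: reduced_append_iff)
    moreover have "last (word_inv z') = letter_inv (hd z')" if "z' \<noteq> []"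
      using that by (simp add: word_inv_def last_rev hd_map)
    ultimately show ?thesis
      using branch s' by (auto simp: reduced_append_iff[of "word_inv z'"])
  qed
  moreover have "reduce (concat (map y (l # m # w))) = reduce (reduce (y l) @ reduce (concat (map y (m # w))))"
    by (simp add: reduce_append_reduce)
  moreover have "\<dots> = reduce (word_inv z' @ s' @ R)"
    using reduce_cancel[of "word_inv z'" p "s' @ R"] red yl s reduced_y[OF l] by simp
  ultimately have eq: "reduce (concat (map y (l # m # w))) = word_inv z' @ s' @ R"
    by simp
  moreover have "length (m # w) \<le> length (s' @ R)"
    using R s'(1) by (cases s') auto
  moreover have "prefix (word_inv (word_inv p)) (y m)" using ym by simp
  ultimately show ?case
    using yl m ml by blast
qed

text \<open>At least one letter of each image survives the cancellation; hence a generator can only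
  be hit by a word of at most one letter.\<close>

theorem length_le_length_image:
  assumes "reduced w" "fst ` set w \<subseteq> {..<n}"
  shows "length w \<le> length (reduce (concat (map y w)))"
proof (cases w)
  case (Cons l w')
  then obtain s t R l'' where st: "y l = s @ t" and red: "reduce (concat (map y w)) = s @ R"
    and R: "length w' \<le> length R"
    and l'': "fst l'' < n" "l'' \<noteq> letter_inv l" "prefix (word_inv t) (y l'')"
    using reduce_concat_Cons[of l w'] assms by auto
  have l: "fst l < n" using assms Cons by simp
  \<comment> \<open>The first letter loses nothing on the left: the empty prefix is used, with
    \<open>letter_inv l\<close> as some letter other than \<open>l\<close>.\<close>
  have "length ([] :: letter list) + length (word_inv t) < length (y l)"
    by (rule cancel_less[of l "letter_inv l" l'']) (use l l'' st in \<open>auto simp: y_inv\<close>)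
  then have "s \<noteq> []" using st by auto
  then show ?thesis using red R Cons by (cases s) auto
qed simp

end

text \<open>No elementary Nielsen move lowers a weight. As \<open>l\<close> and \<open>l'\<close>
  range over inverses too and the weight is symmetric under inversion, multiplications on the left
  are covered.\<close>

locale weight_minimal = letter_images +
  assumes weight_le:
    "\<lbrakk>fst l < n; fst l' < n; fst l \<noteq> fst l'\<rbrakk>
     \<Longrightarrow> word_weight n (y l) \<le> word_weight n (reduce (y l @ y l'))"
begin

lemma fst_neq: "l \<noteq> l' \<Longrightarrow> l' \<noteq> letter_inv l \<Longrightarrow> fst l \<noteq> fst l'"
  by (cases l; cases l') (auto simp: letter_inv_def)

text \<open>If more than half of \<open>y l'\<close> cancelled against
  \<open>y (letter_inv l)\<close>, the product would be shorter than \<open>y l\<close>, hence of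
  smaller weight. For mutually inverse letters, where no such move exists,
  \<open>common_prefix_word_inv\<close> takes over.\<close>

lemma common_prefix_half:
  assumes "fst l < n" "fst l' < n" "l \<noteq> l'" "prefix p (y l)" "prefix p (y l')"
  shows "2 * length p \<le> length (y l')"
proof (cases "l = letter_inv l'")
  case True
  then have "2 * length p < length (y l')"
    using assms by (intro common_prefix_word_inv) (auto simp: reduced_y y_nonempty y_inv)
  then show ?thesis by simp
next
  case False
  obtain u v where u: "y l = p @ u" and v: "y l' = p @ v"
    using assms by (auto simp: prefix_def)
  have inv: "y (letter_inv l) = word_inv u @ word_inv p" by (simp add: y_inv u)
  have "fst (letter_inv l) \<noteq> fst l'"
    using assms(3) False by (intro fst_neq) auto
  then have "word_weight n (y (letter_inv l)) \<le> word_weight n (reduce (y (letter_inv l) @ y l'))"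
    using assms by (intro weight_le) auto
  also have "reduce (y (letter_inv l) @ y l') = reduce (word_inv u @ v)"
    using reduce_cancel[of "word_inv u" p v] by (simp add: inv v)
  finally have le: "word_weight n (y (letter_inv l)) \<le> word_weight n (reduce (word_inv u @ v))" .
  have "fst ` set (reduce (word_inv u @ v)) \<subseteq> fst ` set (word_inv u @ v)"
    by (intro image_mono set_reduce)
  also have "\<dots> \<subseteq> {..<n}"
    using y_letters[OF assms(1)] y_letters[OF assms(2)] u v by (auto simp: image_Un)
  finally have "\<not> length (reduce (word_inv u @ v)) < length (y (letter_inv l))"
    using word_weight_shorter le by (meson leD)
  then show ?thesis
    using length_reduce_le[of "word_inv u @ v"] u v by (simp add: inv)
qed

text \<open>Multiplying \<open>y l'\<close> by \<open>y l\<close> from the left exchanges the prefix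
  \<open>q\<close> for the equally long \<open>p\<close>, which would lower the weight if
  \<open>p\<close> had the smaller code.\<close>

lemma half_cancel_code_le:
  assumes "fst l < n" "fst l' < n" "l' \<noteq> letter_inv l"
    and l: "y l = p @ word_inv q" "length p = length q" and l': "prefix q (y l')"
  shows "word_code (2 * n + 1) q \<le> word_code (2 * n + 1) p"
proof (rule ccontr)
  assume "\<not> ?thesis"
  then have less: "word_code (2 * n + 1) p < word_code (2 * n + 1) q" by simp
  obtain w where w: "y l' = q @ w" using l' by (auto simp: prefix_def)
  have q: "prefix q (y (letter_inv l))" using l(1) by (simp add: y_inv)
  have "2 * length q \<le> length (y l')"
    using assms q by (intro common_prefix_half[of "letter_inv l"]) auto
  then have qw: "length q \<le> length w" by (simp add: w)
  have ne: "l' \<noteq> l"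
  proof
    assume "l' = l"
    then have "2 * length q < length (y l)"
      using reduced_y[OF assms(1)] y_nonempty[OF assms(1)] q l'
      by (intro common_prefix_word_inv) (simp_all add: y_inv)
    then show False using l by simp
  qed
  \<comment> \<open>\<open>weight_le\<close> multiplies on the right, so the move is made on the
    inverse of \<open>y l'\<close>.\<close>
  have "word_weight n (y (letter_inv l')) \<le> word_weight n (reduce (y (letter_inv l') @ y (letter_inv l)))"
    using assms(1-3) ne by (intro weight_le) (use fst_neq[of l l'] in auto)
  also have "y (letter_inv l') @ y (letter_inv l) = word_inv w @ word_inv q @ q @ word_inv p"
    by (simp add: y_inv w l)
  also have "reduce \<dots> = reduce (word_inv w @ word_inv p)"
    by (rule reduce_cancel)
  also have "word_weight n \<dots> \<le> word_weight n (word_inv w @ word_inv p)"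
    using y_letters[OF assms(1)] y_letters[OF assms(2)] w l
    by (intro word_weight_reduce_le) (auto simp: image_Un)
  also have "\<dots> = word_weight n (p @ w)"
    using word_weight_word_inv[of n "p @ w"] by simp
  also have "\<dots> < word_weight n (q @ w)"
    using less l(2) qw y_letters[OF assms(1)] l(1) by (intro word_weight_prefix) (auto simp: image_Un)
  finally show False
    using word_weight_word_inv[of n "q @ w"] by (simp add: y_inv w)
qed

text \<open>Each side cancels at most half of \<open>y l\<close>. If both halves went, comparing
  codes in both directions would force \<open>p = q\<close>, so that
  \<open>y l = p @ word_inv p\<close> would not be reduced.\<close>

sublocale nielsen_reduced
proof
  fix l l' l'' p q
  assume l: "fst l < n" "fst l' < n" "fst l'' < n" "l' \<noteq> l" "l'' \<noteq> letter_inv l"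
    and p: "prefix p (y l)" "prefix p (y l')"
    and q: "prefix q (y (letter_inv l))" "prefix q (y l'')"
  have pl: "2 * length p \<le> length (y l)"
    using l p by (intro common_prefix_half[of l']) auto
  have "2 * length q \<le> length (y (letter_inv l))"
    using l q by (intro common_prefix_half[of l'']) auto
  then have ql: "2 * length q \<le> length (y l)" by (simp add: y_inv)
  show "length p + length q < length (y l)"
  proof (rule ccontr)
    assume "\<not> ?thesis"
    with pl ql have len: "length p = length q" "length (y l) = length p + length q" by auto
    obtain u where u: "y l = p @ u" using p(1) by (auto simp: prefix_def)
    obtain v where v: "y l = v @ word_inv q"
    proof -
      obtain v where "word_inv (y l) = q @ v" using q(1) by (auto simp: prefix_def y_inv)
      then have "y l = word_inv v @ word_inv q" by (metis word_inv_simps(2,3))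
      with that show thesis .
    qed
    have eq: "y l = p @ word_inv q"
      using u v len by (metis add_right_cancel append_eq_append_conv length_append word_inv_simps(4))
    have eq': "y (letter_inv l) = q @ word_inv p" by (simp add: y_inv eq)
    have "word_code (2 * n + 1) q \<le> word_code (2 * n + 1) p"
      using l q eq len by (intro half_cancel_code_le[of l l'']) auto
    moreover have "word_code (2 * n + 1) p \<le> word_code (2 * n + 1) q"
      using l p eq' len by (intro half_cancel_code_le[of "letter_inv l" l']) auto
    ultimately have "p = q"
      using len y_letters[OF l(1)] eq by (intro word_code_inject[of p q n]) (auto simp: image_Un)
    moreover have "p \<noteq> []" using y_nonempty[OF l(1)] len by auto
    ultimately show False
      using reduced_y[OF l(1)] eq
      by (auto simp: reduced_append_iff word_inv_def hd_rev last_map)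
  qed
qed

end

section \<open>Automorphisms of free groups\<close>

lemma AutoGroup_simps:
  "carrier (AutoGroup G) = auto G"
  "\<lbrakk>f \<in> auto G; g \<in> auto G\<rbrakk> \<Longrightarrow> f \<otimes>\<^bsub>AutoGroup G\<^esub> g = compose (carrier G) f g"
  "\<one>\<^bsub>AutoGroup G\<^esub> = (\<lambda>x\<in>carrier G. x)"
  by (simp_all add: AutoGroup_def BijGroup_def auto_def)

context
  fixes n :: nat
begin

abbreviation F where "F \<equiv> free_group n"
abbreviation AutF where "AutF \<equiv> AutoGroup (free_group n)"

interpretation F: group F by (rule free_group_is_group)
interpretation A: group AutF by (rule F.AutoGroup)

lemma AutF_closed: "\<lbrakk>f \<in> carrier AutF; x \<in> carrier F\<rbrakk> \<Longrightarrow> f x \<in> carrier F"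
  by (auto simp: AutoGroup_simps auto_def hom_def)

lemma AutF_comp [simp]:
  "\<lbrakk>f \<in> carrier AutF; g \<in> carrier AutF; x \<in> carrier F\<rbrakk> \<Longrightarrow> (f \<otimes>\<^bsub>AutF\<^esub> g) x = f (g x)"
  by (simp add: AutoGroup_simps compose_def)

lemma AutF_one [simp]: "x \<in> carrier F \<Longrightarrow> \<one>\<^bsub>AutF\<^esub> x = x"
  by (simp add: AutoGroup_simps)

lemma AutF_group_hom: "f \<in> carrier AutF \<Longrightarrow> group_hom F F f"
  by unfold_locales (simp add: AutoGroup_simps auto_def)

lemma AutF_mult:
  "\<lbrakk>f \<in> carrier AutF; x \<in> carrier F; y \<in> carrier F\<rbrakk>
   \<Longrightarrow> f (x \<otimes>\<^bsub>F\<^esub> y) = f x \<otimes>\<^bsub>F\<^esub> f y"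
  using AutF_group_hom group_hom.hom_mult by fastforce

lemma AutF_inv:
  "\<lbrakk>f \<in> carrier AutF; x \<in> carrier F\<rbrakk> \<Longrightarrow> f (inv\<^bsub>F\<^esub> x) = inv\<^bsub>F\<^esub> f x"
  using AutF_group_hom group_hom.hom_inv by fastforce

lemma AutF_inj: "f \<in> carrier AutF \<Longrightarrow> inj_on f (carrier F)"
  by (simp add: AutoGroup_simps auto_def Bij_def bij_betw_def)

lemma AutF_surj: "f \<in> carrier AutF \<Longrightarrow> f ` carrier F = carrier F"
  by (simp add: AutoGroup_simps auto_def Bij_def bij_betw_def)

declare free_gen_closed [simp]

lemma F_hom_eqI:
  assumes "f \<in> hom F F" "g \<in> hom F F" "\<And>i. i < n \<Longrightarrow> f (free_gen i) = g (free_gen i)"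
    and "w \<in> carrier F"
  shows "f w = g w"
proof -
  have "g (free_gen i) \<in> carrier F" if "i < n" for i
    using assms(2) that by (auto simp: hom_def)
  with free_group_universal[OF F.is_group, of n "\<lambda>i. g (free_gen i)"]
  obtain h where "\<forall>h'\<in>hom F F. (\<forall>i<n. h' (free_gen i) = g (free_gen i)) \<longrightarrow>
      (\<forall>w\<in>carrier F. h' w = h w)"
    by blast
  then have eq: "h' w = h w"
    if "h' \<in> hom F F" "\<And>i. i < n \<Longrightarrow> h' (free_gen i) = g (free_gen i)" for h'
    using that assms(4) by blast
  show ?thesis using eq[OF assms(1,3)] eq[OF assms(2)] by simp
qed

lemma AutF_eqI:
  assumes "f \<in> carrier AutF" "g \<in> carrier AutF"
    and "\<And>i. i < n \<Longrightarrow> f (free_gen i) = g (free_gen i)"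
  shows "f = g"
proof (rule extensionalityI)
  show "f \<in> extensional (carrier F)" "g \<in> extensional (carrier F)"
    using assms by (auto simp: AutoGroup_simps auto_def Bij_def)
  fix w assume "w \<in> carrier F"
  moreover have "f \<in> hom F F" "g \<in> hom F F"
    using assms(1,2) by (simp_all add: AutoGroup_simps auto_def)
  ultimately show "f w = g w" using assms(3) by (intro F_hom_eqI[of f g w])
qed

text \<open>Restricted to the carrier because members of \<open>AutoGroup\<close> are extensional
  functions.\<close>

definition free_endo :: "(nat \<Rightarrow> letter list) \<Rightarrow> letter list \<Rightarrow> letter list" where
  "free_endo f = restrict (SOME h. h \<in> hom F F \<and> (\<forall>i<n. h (free_gen i) = f i)) (carrier F)"

lemma
  assumes "\<And>i. i < n \<Longrightarrow> f i \<in> carrier F"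
  shows free_endo_hom: "free_endo f \<in> hom F F"
    and free_endo_gen: "i < n \<Longrightarrow> free_endo f (free_gen i) = f i"
proof -
  define h where "h = (SOME h. h \<in> hom F F \<and> (\<forall>i<n. h (free_gen i) = f i))"
  have "\<exists>h \<in> hom F F. (\<forall>i<n. h (free_gen i) = f i) \<and>
      (\<forall>h' \<in> hom F F. (\<forall>i<n. h' (free_gen i) = f i) \<longrightarrow> (\<forall>w \<in> carrier F. h' w = h w))"
    by (rule free_group_universal[OF F.is_group]) (rule assms)
  then have "\<exists>h. h \<in> hom F F \<and> (\<forall>i<n. h (free_gen i) = f i)" by blast
  from someI_ex[OF this] have h: "h \<in> hom F F" "\<forall>i<n. h (free_gen i) = f i"
    unfolding h_def by blast+
  have eq: "free_endo f = restrict h (carrier F)" by (simp only: free_endo_def h_def)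
  show "free_endo f \<in> hom F F"
    using h(1) by (simp add: eq hom_def Pi_iff)
  show "free_endo f (free_gen i) = f i" if "i < n"
    using h(2) that by (simp add: eq)
qed

lemma free_endo_mult:
  assumes "\<And>i. i < n \<Longrightarrow> f i \<in> carrier F" "x \<in> carrier F" "y \<in> carrier F"
  shows "free_endo f (x \<otimes>\<^bsub>F\<^esub> y) = free_endo f x \<otimes>\<^bsub>F\<^esub> free_endo f y"
  by (rule hom_mult[OF free_endo_hom]) fact+

lemma free_endo_inv:
  assumes "\<And>i. i < n \<Longrightarrow> f i \<in> carrier F" "x \<in> carrier F"
  shows "free_endo f (inv\<^bsub>F\<^esub> x) = inv\<^bsub>F\<^esub> free_endo f x"
proof -
  interpret group_hom F F "free_endo f"
    by unfold_locales (rule free_endo_hom, fact)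
  show ?thesis using assms(2) by (rule hom_inv)
qed

lemma free_endo_in_AutF:
  assumes f: "\<And>i. i < n \<Longrightarrow> f i \<in> carrier F" and g: "\<And>i. i < n \<Longrightarrow> g i \<in> carrier F"
    and "\<And>i. i < n \<Longrightarrow> free_endo f (g i) = free_gen i"
    and "\<And>i. i < n \<Longrightarrow> free_endo g (f i) = free_gen i"
  shows "free_endo f \<in> carrier AutF"
proof -
  have inverse: "free_endo f' (free_endo g' x) = x"
    if x: "x \<in> carrier F" and f': "\<And>i. i < n \<Longrightarrow> f' i \<in> carrier F"
      and g': "\<And>i. i < n \<Longrightarrow> g' i \<in> carrier F"
      and fg: "\<And>i. i < n \<Longrightarrow> free_endo f' (g' i) = free_gen i" for f' g' x
  proof -
    have "compose (carrier F) (free_endo f') (free_endo g') x = (\<lambda>x. x) x"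
    proof (rule F_hom_eqI)
      show "compose (carrier F) (free_endo f') (free_endo g') \<in> hom F F"
        by (rule F.hom_compose; rule free_endo_hom; fact)
      show "(\<lambda>x. x) \<in> hom F F" by (simp add: hom_def)
      show "compose (carrier F) (free_endo f') (free_endo g') (free_gen i) = free_gen i" if "i < n" for i
        using that fg[OF that] free_endo_gen[of g', OF g' that] by (simp add: compose_def)
    qed (fact x)
    then show ?thesis using x by (simp add: compose_def)
  qed
  note fg = inverse[of _ f g, OF _ assms(1,2,3)] and gf = inverse[of _ g f, OF _ assms(2,1,4)]
  have hf: "free_endo f \<in> hom F F" and hg: "free_endo g \<in> hom F F"
    by (rule free_endo_hom, fact)+
  have "bij_betw (free_endo f) (carrier F) (carrier F)"
    by (rule bij_betwI[where g = "free_endo g"]) (use fg gf hf hg in \<open>auto simp: hom_def\<close>)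
  then show ?thesis
    using hf by (auto simp: AutoGroup_simps auto_def Bij_def free_endo_def)
qed

lemma F_inv_cancel [simp]:
  "\<lbrakk>x \<in> carrier F; y \<in> carrier F\<rbrakk> \<Longrightarrow> inv\<^bsub>F\<^esub> x \<otimes>\<^bsub>F\<^esub> (x \<otimes>\<^bsub>F\<^esub> y) = y"
  "\<lbrakk>x \<in> carrier F; y \<in> carrier F\<rbrakk> \<Longrightarrow> x \<otimes>\<^bsub>F\<^esub> (inv\<^bsub>F\<^esub> x \<otimes>\<^bsub>F\<^esub> y) = y"
  by (metis F.inv_closed F.l_inv F.l_one F.m_assoc, metis F.inv_closed F.r_inv F.l_one F.m_assoc)

lemmas F_simps = F.m_assoc F.inv_mult_group

section \<open>Inversions, transvections and quarter turns\<close>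

definition inversion :: "nat \<Rightarrow> letter list \<Rightarrow> letter list" where
  "inversion i = free_endo (\<lambda>k. if k = i then inv\<^bsub>F\<^esub> free_gen i else free_gen k)"

definition transvection :: "nat \<Rightarrow> nat \<Rightarrow> letter list \<Rightarrow> letter list" where
  "transvection i j = free_endo (\<lambda>k. if k = i then free_gen i \<otimes>\<^bsub>F\<^esub> free_gen j else free_gen k)"

text \<open>A transposition of generators, twisted by a sign so that it is a product of transvections.\<close>

definition quarter_turn :: "nat \<Rightarrow> nat \<Rightarrow> letter list \<Rightarrow> letter list" where
  "quarter_turn i j = free_endo
     (\<lambda>k. if k = i then free_gen j else if k = j then inv\<^bsub>F\<^esub> free_gen i else free_gen k)"

lemma inversion_gen [simp]:
  "\<lbrakk>i < n; k < n\<rbrakk>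
   \<Longrightarrow> inversion i (free_gen k) = (if k = i then inv\<^bsub>F\<^esub> free_gen i else free_gen k)"
  unfolding inversion_def by (subst free_endo_gen) auto

lemma transvection_gen [simp]:
  "\<lbrakk>i < n; j < n; k < n\<rbrakk>
   \<Longrightarrow> transvection i j (free_gen k) = (if k = i then free_gen i \<otimes>\<^bsub>F\<^esub> free_gen j else free_gen k)"
  unfolding transvection_def by (subst free_endo_gen) auto

lemma quarter_turn_gen [simp]:
  "\<lbrakk>i < n; j < n; k < n\<rbrakk>
   \<Longrightarrow> quarter_turn i j (free_gen k)
     = (if k = i then free_gen j else if k = j then inv\<^bsub>F\<^esub> free_gen i else free_gen k)"
  unfolding quarter_turn_def by (subst free_endo_gen) auto

lemma inversion_closed [simp]: "i < n \<Longrightarrow> inversion i \<in> carrier AutF"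
  unfolding inversion_def
  by (rule free_endo_in_AutF[where g = "\<lambda>k. if k = i then inv\<^bsub>F\<^esub> free_gen i else free_gen k"])
     (auto simp: free_endo_inv free_endo_gen)

lemma transvection_closed [simp]:
  "\<lbrakk>i < n; j < n; i \<noteq> j\<rbrakk> \<Longrightarrow> transvection i j \<in> carrier AutF"
  unfolding transvection_def
  by (rule free_endo_in_AutF[where g = "\<lambda>k. if k = i then free_gen i \<otimes>\<^bsub>F\<^esub> inv\<^bsub>F\<^esub> free_gen j else free_gen k"])
     (auto simp: free_endo_mult free_endo_inv free_endo_gen F_simps)

lemma quarter_turn_closed [simp]:
  "\<lbrakk>i < n; j < n; i \<noteq> j\<rbrakk> \<Longrightarrow> quarter_turn i j \<in> carrier AutF"
  unfolding quarter_turn_def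
  by (rule free_endo_in_AutF[where
        g = "\<lambda>k. if k = i then inv\<^bsub>F\<^esub> free_gen j else if k = j then free_gen i else free_gen k"])
     (auto simp: free_endo_inv free_endo_gen)

lemmas AutF_hom_simps [simp] =
  AutF_mult[OF inversion_closed] AutF_inv[OF inversion_closed] AutF_closed[OF inversion_closed]
  AutF_mult[OF transvection_closed] AutF_inv[OF transvection_closed] AutF_closed[OF transvection_closed]
  AutF_mult[OF quarter_turn_closed] AutF_inv[OF quarter_turn_closed] AutF_closed[OF quarter_turn_closed]

definition left_transvection :: "nat \<Rightarrow> nat \<Rightarrow> letter list \<Rightarrow> letter list" where
  "left_transvection i j = inversion i \<otimes>\<^bsub>AutF\<^esub> transvection i j \<otimes>\<^bsub>AutF\<^esub> inversion i"

lemma left_transvection_closed [simp]: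
  "\<lbrakk>i < n; j < n; i \<noteq> j\<rbrakk> \<Longrightarrow> left_transvection i j \<in> carrier AutF"
  by (simp add: left_transvection_def)

lemmas left_transvection_hom_simps [simp] =
  AutF_mult[OF left_transvection_closed] AutF_inv[OF left_transvection_closed]
  AutF_closed[OF left_transvection_closed]

lemma left_transvection_gen [simp]:
  "\<lbrakk>i < n; j < n; k < n; i \<noteq> j\<rbrakk> \<Longrightarrow> left_transvection i j (free_gen k)
     = (if k = i then inv\<^bsub>F\<^esub> free_gen j \<otimes>\<^bsub>F\<^esub> free_gen i else free_gen k)"
  by (simp add: left_transvection_def F_simps)

lemma inversion_inversion: "i < n \<Longrightarrow> inversion i \<otimes>\<^bsub>AutF\<^esub> inversion i = \<one>\<^bsub>AutF\<^esub>"
  by (rule AutF_eqI) auto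

text \<open>Makes \<open>transvection i k\<close> a commutator built from
  \<open>transvection i j\<close> and \<open>transvection j k\<close>.\<close>

lemma transvection_commutator:
  "\<lbrakk>i < n; j < n; k < n; i \<noteq> k; j \<noteq> i; j \<noteq> k\<rbrakk>
   \<Longrightarrow> transvection j k \<otimes>\<^bsub>AutF\<^esub> transvection i j
     = transvection i j \<otimes>\<^bsub>AutF\<^esub> transvection j k \<otimes>\<^bsub>AutF\<^esub> transvection i k"
  by (rule AutF_eqI) (auto simp: F_simps)

text \<open>Solved for \<open>quarter_turn i j\<close>, this writes it in terms of transvections; in
  this form no inverse automorphism has to be evaluated.\<close>

lemma quarter_turn_eq:
  "\<lbrakk>i < n; j < n; i \<noteq> j\<rbrakk>
   \<Longrightarrow> left_transvection i j \<otimes>\<^bsub>AutF\<^esub> quarter_turn i j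
     = left_transvection j i \<otimes>\<^bsub>AutF\<^esub> transvection i j"
  by (rule AutF_eqI) (auto simp: F_simps)

lemma quarter_turn_quarter_turn:
  "\<lbrakk>i < n; j < n; i \<noteq> j\<rbrakk>
   \<Longrightarrow> quarter_turn i j \<otimes>\<^bsub>AutF\<^esub> quarter_turn i j = inversion i \<otimes>\<^bsub>AutF\<^esub> inversion j"
  by (rule AutF_eqI) auto

lemma F_mult: "u \<otimes>\<^bsub>F\<^esub> v = reduce (u @ v)"
  by (simp add: free_group_def)

lemma F_one: "\<one>\<^bsub>F\<^esub> = []"
  by (simp add: free_group_def)

lemma F_carrier: "w \<in> carrier F \<longleftrightarrow> reduced w \<and> fst ` set w \<subseteq> {..<n}"
  by (simp add: free_group_def)

lemma F_inv: "w \<in> carrier F \<Longrightarrow> inv\<^bsub>F\<^esub> w = word_inv w"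
proof (rule F.inv_equality)
  show "word_inv w \<otimes>\<^bsub>F\<^esub> w = \<one>\<^bsub>F\<^esub>"
    using reduce_cancel[of "[]" w "[]"] by (simp add: F_mult F_one reduce_def)
qed (auto simp: F_carrier)

lemma F_letter: "i < n \<Longrightarrow> [(i, b)] = (if b then free_gen i else inv\<^bsub>F\<^esub> free_gen i)"
  by (simp add: inv_free_gen) (simp add: free_gen_def)

text \<open>Brings automorphisms into the form to which the cancellation estimates for words in
  letter images apply.\<close>

lemma AutF_apply_word:
  assumes "f \<in> carrier AutF" "w \<in> carrier F"
  shows "f w = reduce (concat (map (\<lambda>l. f [l]) w))"
  using assms(2)
proof (induction w)
  case Nil
  then show ?case
    using group_hom.hom_one[OF AutF_group_hom[OF assms(1)]] by (simp add: F_one reduce_def)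
next
  case (Cons l w)
  then have w: "w \<in> carrier F" and l: "[l] \<in> carrier F"
    by (auto simp: F_carrier dest: reduced_ConsD)
  have "l # w = [l] \<otimes>\<^bsub>F\<^esub> w"
    using Cons.prems by (simp add: F_mult F_carrier)
  then have "f (l # w) = f [l] \<otimes>\<^bsub>F\<^esub> f w"
    using assms(1) w l by (simp add: AutF_mult)
  also have "\<dots> = reduce (reduce (f [l]) @ reduce (concat (map (\<lambda>l. f [l]) w)))"
    using Cons.IH[OF w] AutF_closed[OF assms(1) l] by (simp add: F_mult F_carrier)
  finally show ?case by (simp add: reduce_append_reduce)
qed

end

section \<open>Nielsen's theorem on generators of the automorphism group\<close>

context
  fixes n :: nat
begin

interpretation F: group "F n" by (rule free_group_is_group)
interpretation A: group "AutF n" by (rule F.AutoGroup)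

definition nielsen_gens where
  "nielsen_gens = inversion n ` {..<n} \<union> {transvection n i j |i j. i < n \<and> j < n \<and> i \<noteq> j}"

lemma nielsen_gens_subset: "nielsen_gens \<subseteq> carrier (AutF n)"
  by (auto simp: nielsen_gens_def)

abbreviation nielsen_group where "nielsen_group \<equiv> generate (AutF n) nielsen_gens"

interpretation N: subgroup nielsen_group "AutF n"
  by (rule A.generate_is_subgroup[OF nielsen_gens_subset])

lemma inversion_in_nielsen: "i < n \<Longrightarrow> inversion n i \<in> nielsen_group"
  by (rule generate.incl) (simp add: nielsen_gens_def)

lemma transvection_in_nielsen: "\<lbrakk>i < n; j < n; i \<noteq> j\<rbrakk> \<Longrightarrow> transvection n i j \<in> nielsen_group"
  by (rule generate.incl) (auto simp: nielsen_gens_def)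

lemma left_transvection_in_nielsen:
  "\<lbrakk>i < n; j < n; i \<noteq> j\<rbrakk> \<Longrightarrow> left_transvection n i j \<in> nielsen_group"
  unfolding left_transvection_def
  by (intro N.m_closed inversion_in_nielsen transvection_in_nielsen)

lemma nielsen_group_cancel:
  assumes "f \<in> carrier (AutF n)" "t \<in> nielsen_group" "f \<otimes>\<^bsub>AutF n\<^esub> t \<in> nielsen_group"
  shows "f \<in> nielsen_group"
proof -
  have "f = (f \<otimes>\<^bsub>AutF n\<^esub> t) \<otimes>\<^bsub>AutF n\<^esub> inv\<^bsub>AutF n\<^esub> t"
    using assms N.mem_carrier by (simp add: A.m_assoc)
  also have "\<dots> \<in> nielsen_group" using assms by simp
  finally show ?thesis .
qed

lemma quarter_turn_in_nielsen:
  assumes "i < n" "j < n" "i \<noteq> j"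
  shows "quarter_turn n i j \<in> nielsen_group"
proof -
  have "quarter_turn n i j = inv\<^bsub>AutF n\<^esub> left_transvection n i j
      \<otimes>\<^bsub>AutF n\<^esub> (left_transvection n j i \<otimes>\<^bsub>AutF n\<^esub> transvection n i j)"
    using assms quarter_turn_eq[OF assms]
    by (intro A.inv_solve_left[THEN iffD2]) auto
  also have "\<dots> \<in> nielsen_group"
    using assms by (intro N.m_closed N.m_inv_closed left_transvection_in_nielsen transvection_in_nielsen) auto
  finally show ?thesis .
qed

text \<open>Conjugating a transvection by inversions adjusts the signs. This may yield the inverse
  of the intended product, which is harmless since \<open>word_weight\<close> is symmetric.\<close>

lemma nielsen_move:
  assumes "i < n" "j < n" "i \<noteq> j"
  obtains t where "t \<in> nielsen_group"
    and "t (free_gen i) = [(i, a)] \<otimes>\<^bsub>F n\<^esub> [(j, b)]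
       \<or> t (free_gen i) = inv\<^bsub>F n\<^esub> ([(i, a)] \<otimes>\<^bsub>F n\<^esub> [(j, b)])"
    and "\<And>k. \<lbrakk>k < n; k \<noteq> i\<rbrakk> \<Longrightarrow> t (free_gen k) = free_gen k"
proof -
  let ?R = "transvection n i j"
  let ?c = "\<lambda>k f. inversion n k \<otimes>\<^bsub>AutF n\<^esub> f \<otimes>\<^bsub>AutF n\<^esub> inversion n k"
  define t where "t = (if a then if b then ?R else ?c j ?R
                       else if b then ?c i ?R else ?c i (?c j ?R))"
  note in_nielsen = inversion_in_nielsen transvection_in_nielsen
  show thesis
  proof (rule that)
    show "t \<in> nielsen_group"
      using assms by (auto simp: t_def intro!: N.m_closed in_nielsen)
    show "t (free_gen i) = [(i, a)] \<otimes>\<^bsub>F n\<^esub> [(j, b)]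
       \<or> t (free_gen i) = inv\<^bsub>F n\<^esub> ([(i, a)] \<otimes>\<^bsub>F n\<^esub> [(j, b)])"
      using assms by (auto simp: t_def F_letter F_simps)
    show "t (free_gen k) = free_gen k" if "k < n" "k \<noteq> i" for k
      using assms that by (auto simp: t_def)
  qed
qed

lemma free_gen_neq:
  assumes "i < n" "k < n" "k \<noteq> i"
  shows "free_gen k \<noteq> free_gen i" "free_gen k \<noteq> inv\<^bsub>F n\<^esub> free_gen i"
  using assms by (auto simp: inv_free_gen) (auto simp: free_gen_def)

text \<open>Sorting, by induction over the generators that may still be moved: precomposing with a
  quarter turn and an inversion fixes generator \<open>i\<close> and keeps those already
  fixed.\<close>

lemma signed_permutation_in_nielsen:
  assumes "finite S" "f \<in> carrier (AutF n)"
    and "\<And>i. i < n \<Longrightarrow> \<exists>j<n. f (free_gen j) \<in> {free_gen i, inv\<^bsub>F n\<^esub> free_gen i}"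
    and "\<And>i. \<lbrakk>i < n; i \<notin> S\<rbrakk> \<Longrightarrow> f (free_gen i) = free_gen i"
  shows "f \<in> nielsen_group"
  using assms
proof (induction S arbitrary: f rule: finite_induct)
  case empty
  then have "f = \<one>\<^bsub>AutF n\<^esub>" by (intro AutF_eqI) auto
  then show ?case by simp
next
  case (insert i S)
  note hom = AutF_mult[OF insert.prems(1)] AutF_inv[OF insert.prems(1)] AutF_closed[OF insert.prems(1)]
  show ?case
  proof (cases "i < n \<and> f (free_gen i) \<noteq> free_gen i")
    case False
    with insert show ?thesis by (metis insert_iff)
  next
    case True
    then have i: "i < n" and fi: "f (free_gen i) \<noteq> free_gen i" by auto
    obtain j where j: "j < n" "f (free_gen j) \<in> {free_gen i, inv\<^bsub>F n\<^esub> free_gen i}"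
      using insert.prems(2)[OF i] by blast
    \<comment> \<open>\<open>t\<close> sends generator \<open>i\<close> to generator
      \<open>j\<close>, whose image under \<open>f\<close> is generator \<open>i\<close> up to sign;
      \<open>u\<close> below corrects the sign.\<close>
    define t where "t = (if j = i then \<one>\<^bsub>AutF n\<^esub> else quarter_turn n i j)"
    have t: "t \<in> nielsen_group" "t \<in> carrier (AutF n)"
      using i j quarter_turn_in_nielsen by (auto simp: t_def)
    define u where "u = (if f (free_gen j) = free_gen i then \<one>\<^bsub>AutF n\<^esub> else inversion n i)"
    have u: "u \<in> nielsen_group" "u \<in> carrier (AutF n)"
      using i inversion_in_nielsen by (auto simp: u_def)
    have tu_i: "f (t (u (free_gen i))) = free_gen i"
      using i j hom by (auto simp: t_def u_def)
    have tu_k: "f (t (u (free_gen k))) = free_gen k" if "k < n" "k \<noteq> i" "f (free_gen k) = free_gen k" for k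
    proof -
      have "k \<noteq> j" using j(2) that free_gen_neq[OF i, of k] by auto
      then show ?thesis using i j that by (auto simp: t_def u_def)
    qed
    have "f \<otimes>\<^bsub>AutF n\<^esub> (t \<otimes>\<^bsub>AutF n\<^esub> u) \<in> nielsen_group"
    proof (rule insert.IH)
      show "f \<otimes>\<^bsub>AutF n\<^esub> (t \<otimes>\<^bsub>AutF n\<^esub> u) \<in> carrier (AutF n)"
        using insert.prems(1) t u by simp
      show "(f \<otimes>\<^bsub>AutF n\<^esub> (t \<otimes>\<^bsub>AutF n\<^esub> u)) (free_gen k) = free_gen k" if "k < n" "k \<notin> S" for k
        using tu_i tu_k[of k] insert.prems(1) insert.prems(3)[of k] t u that by (cases "k = i") auto
      show "\<exists>m<n. (f \<otimes>\<^bsub>AutF n\<^esub> (t \<otimes>\<^bsub>AutF n\<^esub> u)) (free_gen m) \<in> {free_gen k, inv\<^bsub>F n\<^esub> free_gen k}"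
        if k: "k < n" for k
      proof -
        obtain m where m: "m < n" "f (free_gen m) \<in> {free_gen k, inv\<^bsub>F n\<^esub> free_gen k}"
          using insert.prems(2)[OF k] by blast
        \<comment> \<open>Up to sign, \<open>t\<close> and \<open>u\<close> exchange the indices
          \<open>i\<close> and \<open>j\<close> and fix the others, so \<open>m'\<close> is the
          index carried to \<open>m\<close>.\<close>
        define m' where "m' = (if m = i then j else if m = j then i else m)"
        have "f (t (u (free_gen m'))) \<in> {f (free_gen m), inv\<^bsub>F n\<^esub> f (free_gen m)}"
          using i j m(1) hom by (auto simp: t_def u_def m'_def)
        moreover have "m' < n" using i j m by (simp add: m'_def)
        ultimately show ?thesis
          using m k insert.prems(1) t u by (intro exI[of _ m']) auto
      qed
    qed
    then show ?thesis
      using insert.prems(1) t u by (intro nielsen_group_cancel[of f "t \<otimes>\<^bsub>AutF n\<^esub> u"]) auto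
  qed
qed

text \<open>By surjectivity some word \<open>w\<close> is mapped to generator \<open>i\<close>;
  minimality makes the letter images Nielsen reduced, so \<open>w\<close> is a single
  letter.\<close>

lemma weight_minimal_imp_signed_permutation:
  assumes f: "f \<in> carrier (AutF n)"
    and min: "\<And>i a j b. \<lbrakk>i < n; j < n; i \<noteq> j\<rbrakk>
       \<Longrightarrow> word_weight n (f [(i, a)]) \<le> word_weight n (f [(i, a)] \<otimes>\<^bsub>F n\<^esub> f [(j, b)])"
    and i: "i < n"
  shows "\<exists>j<n. f (free_gen j) \<in> {free_gen i, inv\<^bsub>F n\<^esub> free_gen i}"
proof -
  \<comment> \<open>\<open>y_inv\<close> is required of all letters; out of range the empty word
    satisfies it.\<close>
  define y where "y l = (if fst l < n then f [l] else [])" for l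
  have letter: "[l] \<in> carrier (F n)" if "fst l < n" for l
    using that by (simp add: F_carrier)
  have image: "f [l] \<in> carrier (F n)" if "fst l < n" for l
    using AutF_closed[OF f letter[OF that]] .
  have f_inv: "f [letter_inv l] = word_inv (f [l])" if "fst l < n" for l
  proof -
    have "[letter_inv l] = inv\<^bsub>F n\<^esub> [l]"
      using F_inv[OF letter[OF that]] by (simp add: word_inv_def)
    then show ?thesis
      using AutF_inv[OF f letter[OF that]] F_inv[OF image[OF that]] by simp
  qed
  have f_one: "f [] = []"
    using AutF_apply_word[OF f, of "[]"] by (simp add: F_carrier reduce_def)
  interpret weight_minimal n y
  proof
    show "y l \<noteq> []" if "fst l < n" for l
    proof
      assume "y l = []"
      then have "f [l] = f []" using that f_one by (simp add: y_def)
      then have "[l] = []"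
        using letter[OF that] by (rule inj_onD[OF AutF_inj[OF f]]) (simp add: F_carrier)
      then show False by simp
    qed
    show "word_weight n (y l) \<le> word_weight n (reduce (y l @ y l'))"
      if "fst l < n" "fst l' < n" "fst l \<noteq> fst l'" for l l'
      using min[of "fst l" "fst l'" "snd l" "snd l'"] that by (simp add: y_def F_mult)
  qed (use image f_inv in \<open>auto simp: y_def F_carrier\<close>)
  have "free_gen i \<in> f ` carrier (F n)"
    using free_gen_closed[OF i] AutF_surj[OF f] by simp
  then obtain w where w: "w \<in> carrier (F n)" "f w = free_gen i" by (elim imageE) simp
  have "map y w = map (\<lambda>l. f [l]) w" using w(1) by (auto simp: y_def F_carrier)
  then have "reduce (concat (map y w)) = free_gen i"
    by (simp only: AutF_apply_word[OF f w(1), symmetric] w(2))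
  then have "length w \<le> 1"
    using length_le_length_image[of w] w(1) by (simp add: F_carrier free_gen_def)
  moreover have "w \<noteq> []" using w(2) f_one by (auto simp: free_gen_def)
  ultimately obtain l where wl: "w = [l]" by (cases w) simp_all
  obtain j b where jb: "w = [(j, b)]" by (cases l) (use wl in simp)
  then have j: "j < n" using w(1) by (simp add: F_carrier)
  note fj = AutF_inv[OF f free_gen_closed[OF j]] AutF_closed[OF f free_gen_closed[OF j]]
  have "f (free_gen j) = free_gen i \<or> f (free_gen j) = inv\<^bsub>F n\<^esub> free_gen i"
  proof (cases b)
    case True
    then show ?thesis using w(2) by (simp add: jb free_gen_def)
  next
    case False
    then have "inv\<^bsub>F n\<^esub> f (free_gen j) = free_gen i"
      using w(2) F_letter[OF j, of b] fj(1) by (simp add: jb)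
    then show ?thesis using F.inv_inv[OF fj(2)] by simp
  qed
  then show ?thesis using j by blast
qed

text \<open>Descent on the total weight of the generator images: a move that lowers it is
  precomposition with an element of \<open>nielsen_group\<close>; once no move does,
  \<open>f\<close> permutes the generators up to sign.\<close>

theorem AutF_generated: "nielsen_group = carrier (AutF n)"
proof
  show "nielsen_group \<subseteq> carrier (AutF n)" by (rule N.subset)
  show "carrier (AutF n) \<subseteq> nielsen_group"
  proof
    fix f assume "f \<in> carrier (AutF n)"
    then show "f \<in> nielsen_group"
    proof (induction f rule: measure_induct_rule[of "\<lambda>f. \<Sum>i<n. word_weight n (f (free_gen i))"])
      case (less f)
      note f = \<open>f \<in> carrier (AutF n)\<close>
      show ?case
      proof (cases "\<exists>i a j b. i < n \<and> j < n \<and> i \<noteq> j \<and>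
          word_weight n (f [(i, a)] \<otimes>\<^bsub>F n\<^esub> f [(j, b)]) < word_weight n (f [(i, a)])")
        case True
        then obtain i a j b where ij: "i < n" "j < n" "i \<noteq> j"
          and lt: "word_weight n (f [(i, a)] \<otimes>\<^bsub>F n\<^esub> f [(j, b)]) < word_weight n (f [(i, a)])"
          by blast
        let ?u = "[(i, a)] \<otimes>\<^bsub>F n\<^esub> [(j, b)]"
        have letters: "[(i, a)] \<in> carrier (F n)" "[(j, b)] \<in> carrier (F n)"
          using ij by (auto simp: F_carrier)
        then have u: "?u \<in> carrier (F n)" by simp
        have weight_inv: "word_weight n (f (inv\<^bsub>F n\<^esub> x)) = word_weight n (f x)" if "x \<in> carrier (F n)" for x
          using that AutF_inv[OF f that] F_inv[OF AutF_closed[OF f that]] by simp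
        obtain t where t: "t \<in> nielsen_group"
          and ti: "t (free_gen i) = ?u \<or> t (free_gen i) = inv\<^bsub>F n\<^esub> ?u"
          and tk: "\<And>k. \<lbrakk>k < n; k \<noteq> i\<rbrakk> \<Longrightarrow> t (free_gen k) = free_gen k"
          using nielsen_move[OF ij, of a b] by metis
        note tA = N.mem_carrier[OF t]
        have "word_weight n (f (t (free_gen i))) = word_weight n (f ?u)"
          using ti weight_inv[OF u] by auto
        also have "\<dots> < word_weight n (f [(i, a)])"
          using lt AutF_mult[OF f letters] by simp
        also have "\<dots> = word_weight n (f (free_gen i))"
          using ij weight_inv[of "free_gen i"] by (simp add: F_letter)
        finally have lt_i: "word_weight n (f (t (free_gen i))) < word_weight n (f (free_gen i))" .
        have "(\<Sum>k<n. word_weight n (f (t (free_gen k)))) < (\<Sum>k<n. word_weight n (f (free_gen k)))"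
        proof (rule sum_strict_mono_ex1)
          show "\<forall>k\<in>{..<n}. word_weight n (f (t (free_gen k))) \<le> word_weight n (f (free_gen k))"
            using lt_i tk by (metis lessThan_iff less_imp_le order_refl)
          show "\<exists>k\<in>{..<n}. word_weight n (f (t (free_gen k))) < word_weight n (f (free_gen k))"
            using lt_i ij(1) by blast
        qed simp
        then have "(\<Sum>k<n. word_weight n ((f \<otimes>\<^bsub>AutF n\<^esub> t) (free_gen k)))
            < (\<Sum>k<n. word_weight n (f (free_gen k)))"
          using f tA by simp
        then have "f \<otimes>\<^bsub>AutF n\<^esub> t \<in> nielsen_group"
          using f tA by (intro less.IH) auto
        then show ?thesis by (rule nielsen_group_cancel[OF f t])
      next
        case False
        have "word_weight n (f [(i, a)]) \<le> word_weight n (f [(i, a)] \<otimes>\<^bsub>F n\<^esub> f [(j, b)])"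
          if "i < n" "j < n" "i \<noteq> j" for i a j b
          using False that by (meson not_less)
        note signed = weight_minimal_imp_signed_permutation[OF f this]
        show ?thesis
          by (rule signed_permutation_in_nielsen[of "{..<n}"]) (use f signed in simp_all)
      qed
    qed
  qed
qed

end

section \<open>Normal subgroups of symmetric groups\<close>

text \<open>Following \<open>p\<close> by the transposition of \<open>p x\<close> and
  \<open>y\<close> adds the new pair and does not disturb \<open>ys\<close>, which contains neither
  \<open>p x\<close> nor \<open>y\<close>.\<close>

lemma ex_permutes_map_eq:
  assumes "length xs = length ys" "distinct xs" "distinct ys" "set xs \<subseteq> S" "set ys \<subseteq> S"
  shows "\<exists>p. p permutes S \<and> map p xs = ys"
  using assms
proof (induction xs ys rule: list_induct2)
  case Nil
  then show ?case using permutes_id by blast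
next
  case (Cons x xs y ys)
  then obtain p where p: "p permutes S" "map p xs = ys" by auto
  have "p x \<notin> set ys"
    using Cons.prems(1) p permutes_inj[OF p(1)] by (auto simp: inj_image_mem_iff)
  then have "map (transpose (p x) y \<circ> p) xs = ys"
    using Cons.prems(2) p(2) by (metis distinct.simps(2) list.map_comp map_idI transpose_apply_other)
  moreover have "transpose (p x) y \<circ> p permutes S"
    using Cons.prems p(1) permutes_in_image[OF p(1)]
    by (intro permutes_compose permutes_swap_id) auto
  moreover have "(transpose (p x) y \<circ> p) x = y" by simp
  ultimately show ?case by (metis list.simps(9))
qed

text \<open>Commutators with transpositions produce a product of two transpositions, and if these
  overlap then the resulting 3-cycle and a conjugate of it have a double transposition as product.\<close>

lemma normal_sym_group_double_transposition:
  assumes normal: "N \<lhd> sym_group m" and "p \<in> N" "p \<noteq> id" and m: "4 \<le> m"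
    and abcd: "{a, b, c, d} \<subseteq> {1..m}" "distinct [a, b, c, d]"
  shows "transpose a b \<circ> transpose c d \<in> N"
proof -
  interpret S: group "sym_group m" by (rule sym_group_is_group)
  interpret N: normal N "sym_group m" by fact
  have comp: "q \<circ> r \<in> N" if "q \<in> N" "r \<in> N" for q r
    using N.m_closed[OF that] by (simp add: sym_group_mult)
  have conj: "q \<circ> r \<circ> inv' q \<in> N" if "r \<in> N" "q permutes {1..m}" for q r
    using N.inv_op_closed2[of q r] that by (simp add: sym_group_mult sym_group_carrier)
  have inv: "inv' r \<in> N" if "r \<in> N" for r
    using N.m_inv_closed[OF that] N.mem_carrier[OF that] by simp
  have tr: "transpose x y permutes {1..m}" if "x \<in> {1..m}" "y \<in> {1..m}" for x y
    using that by (simp add: permutes_swap_id)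
  have conj_tr: "transpose x y \<circ> r \<circ> transpose x y \<in> N"
    if "r \<in> N" "x \<in> {1..m}" "y \<in> {1..m}" for r x y
    using conj[OF that(1) tr[OF that(2,3)]] by simp
  have fresh: "\<exists>w\<in>{1..m}. w \<notin> set xs" if "length xs < m" for xs
  proof (rule ccontr)
    assume "\<not> ?thesis"
    then have "{1..m} \<subseteq> set xs" by auto
    then have "m \<le> card (set xs)" using card_mono[of "set xs" "{1..m}"] by simp
    then show False using that card_length[of xs] by simp
  qed
  have from_three_cycle: "\<exists>a b c d. {a, b, c, d} \<subseteq> {1..m} \<and> distinct [a, b, c, d]
      \<and> transpose a b \<circ> transpose c d \<in> N"
    if xyz: "{x, y, z} \<subseteq> {1..m}" "distinct [x, y, z]" "transpose x y \<circ> transpose y z \<in> N" for x y z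
  proof -
    obtain w where w: "w \<in> {1..m}" "w \<notin> {x, y, z}"
      using fresh[of "[x, y, z]"] m by auto
    let ?s = "transpose x y \<circ> transpose y z"
    have "transpose z w \<circ> ?s \<circ> transpose z w \<in> N"
      using xyz w by (intro conj_tr) auto
    then have "?s \<circ> (transpose z w \<circ> ?s \<circ> transpose z w) \<in> N"
      by (rule comp[OF xyz(3)])
    also have "?s \<circ> (transpose z w \<circ> ?s \<circ> transpose z w) = transpose x z \<circ> transpose y w"
    proof
      fix v
      consider "v = x" | "v = y" | "v = z" | "v = w" | "v \<notin> {x, y, z, w}" by blast
      then show "(?s \<circ> (transpose z w \<circ> ?s \<circ> transpose z w)) v = (transpose x z \<circ> transpose y w) v"
        using xyz(2) w by cases simp_all
    qed
    finally have "transpose x z \<circ> transpose y w \<in> N" .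
    moreover have "{x, z, y, w} \<subseteq> {1..m}" "distinct [x, z, y, w]" using xyz(1,2) w by auto
    ultimately show ?thesis by blast
  qed
  have swap_left: "q \<circ> transpose x y = transpose (q x) (q y) \<circ> q"
    if "q permutes {1..m}" for q x y
    using permutes_inj[OF that] by (auto simp: fun_eq_iff transpose_def inj_eq)
  have p: "p permutes {1..m}"
    using N.mem_carrier[OF assms(2)] by (simp add: sym_group_carrier)
  obtain u where pu: "p u \<noteq> u" using assms(3) by (auto simp: fun_eq_iff)
  then have u: "u \<in> {1..m}" using p by (metis permutes_not_in)
  then have pu_in: "p u \<in> {1..m}" using permutes_in_image[OF p] by blast
  \<comment> \<open>This choice keeps \<open>p u\<close> outside \<open>{u, w}\<close>, so the two
    transpositions forming the commutator below share at most one point and do not cancel.\<close>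
  obtain w where w: "w \<in> {1..m}" "w \<notin> {u, p u}"
    using fresh[of "[u, p u]"] m by auto
  then have pw: "p w \<in> {1..m}" using permutes_in_image[OF p] by blast
  have pw_neq: "p w \<noteq> p u" using w permutes_inj[OF p] by (auto simp: inj_eq)
  have "(transpose u w \<circ> p \<circ> transpose u w) \<circ> inv' p \<in> N"
    using u w by (intro comp conj_tr inv assms(2))
  also have "(transpose u w \<circ> p \<circ> transpose u w) \<circ> inv' p
      = transpose u w \<circ> (p \<circ> transpose u w \<circ> inv' p)"
    by (simp add: comp_assoc)
  also have "p \<circ> transpose u w \<circ> inv' p = transpose (p u) (p w)"
    using swap_left[OF p, of u w] permutes_inv_o(1)[OF p] by (simp add: comp_assoc)
  finally have comm: "transpose u w \<circ> transpose (p u) (p w) \<in> N" .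
  have "\<exists>a b c d. {a, b, c, d} \<subseteq> {1..m} \<and> distinct [a, b, c, d]
      \<and> transpose a b \<circ> transpose c d \<in> N"
  proof -
    \<comment> \<open>The two transpositions overlap exactly if \<open>p w\<close> is
      \<open>w\<close> or \<open>u\<close>.\<close>
    consider "p w = w" | "p w = u" | "p w \<notin> {u, w}" by blast
    then show ?thesis
    proof cases
      case 1
      then show ?thesis
        using comm u w pu pu_in
        by (intro from_three_cycle[of u w "p u"]) (auto simp: transpose_commute[of "p u" w])
    next
      case 2
      then show ?thesis
        using comm u w pu pu_in
        by (intro from_three_cycle[of w u "p u"]) (auto simp: transpose_commute[of u w] transpose_commute[of "p u" u])
    next
      case 3
      then show ?thesis
        using comm u w pu pu_in pw pw_neq
        by (intro exI[of _ u] exI[of _ w] exI[of _ "p u"] exI[of _ "p w"] conjI) simp_all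
    qed
  qed
  then obtain a' b' c' d' where *: "{a', b', c', d'} \<subseteq> {1..m}" "distinct [a', b', c', d']"
    and mem: "transpose a' b' \<circ> transpose c' d' \<in> N" by blast
  \<comment> \<open>All double transpositions are conjugate: \<open>g\<close> carries one quadruple
    of points to the other.\<close>
  obtain g where g: "g permutes {1..m}" "g a' = a" "g b' = b" "g c' = c" "g d' = d"
    using ex_permutes_map_eq[of "[a', b', c', d']" "[a, b, c, d]" "{1..m}"] * abcd by auto
  have "g \<circ> (transpose a' b' \<circ> transpose c' d') \<circ> inv' g \<in> N"
    by (rule conj[OF mem g(1)])
  also have "g \<circ> (transpose a' b' \<circ> transpose c' d') \<circ> inv' g
      = transpose a b \<circ> (g \<circ> transpose c' d') \<circ> inv' g"
    using swap_left[OF g(1), of a' b'] g by (simp flip: comp_assoc)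
  also have "\<dots> = transpose a b \<circ> transpose c d"
    using swap_left[OF g(1), of c' d'] g permutes_inv_o(1)[OF g(1)] by (simp add: comp_assoc)
  finally show ?thesis .
qed

section \<open>The symmetric group inside the automorphism group\<close>

context
  fixes n :: nat
begin

interpretation F: group "F n" by (rule free_group_is_group)
interpretation A: group "AutF n" by (rule F.AutoGroup)

text \<open>The fundamental group of the graph with two vertices and \<open>n + 1\<close> parallel edges
  \<open>e\<^sub>1, \<dots>, e\<^sub>n\<^sub>+\<^sub>1\<close> is free on the loops \<open>x\<^sub>k = e\<^sub>k e\<^sub>n\<^sub>+\<^sub>1\<^sup>-\<^sup>1\<close>, and permuting the edges by \<open>p\<close>
  sends \<open>x\<^sub>k\<close> to \<open>x\<^bsub>p k\<^esub> x\<^bsub>p (n + 1)\<^esub>\<^sup>-\<^sup>1\<close>. Here \<open>edge_gen k\<close> is \<open>x\<^sub>k\<close>, which is trivial for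
  \<open>k = n + 1\<close>; note the shift by one against \<open>free_gen\<close>.\<close>

definition edge_gen :: "nat \<Rightarrow> letter list" where
  "edge_gen k = (if k = n + 1 then \<one>\<^bsub>F n\<^esub> else free_gen (k - 1))"

definition sym_rep :: "(nat \<Rightarrow> nat) \<Rightarrow> letter list \<Rightarrow> letter list" where
  "sym_rep p = free_endo n (\<lambda>i. edge_gen (p (Suc i)) \<otimes>\<^bsub>F n\<^esub> inv\<^bsub>F n\<^esub> edge_gen (p (n + 1)))"

lemma edge_gen_closed [simp]: "k \<in> {1..n + 1} \<Longrightarrow> edge_gen k \<in> carrier (F n)"
  by (auto simp: edge_gen_def)

lemma edge_gen_Suc [simp]: "i < n \<Longrightarrow> edge_gen (Suc i) = free_gen i"
  by (simp add: edge_gen_def)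

lemma sym_rep_image_closed:
  assumes p: "p permutes {1..n + 1}" and "i < n"
  shows "edge_gen (p (Suc i)) \<otimes>\<^bsub>F n\<^esub> inv\<^bsub>F n\<^esub> edge_gen (p (n + 1)) \<in> carrier (F n)"
proof -
  have "p (Suc i) \<in> {1..n + 1}" "p (n + 1) \<in> {1..n + 1}"
    using assms permutes_in_image[OF p] by auto
  then show ?thesis by (intro F.m_closed F.inv_closed edge_gen_closed)
qed

lemma sym_rep_gen:
  assumes p: "p permutes {1..n + 1}" and "i < n"
  shows "sym_rep p (free_gen i) = edge_gen (p (Suc i)) \<otimes>\<^bsub>F n\<^esub> inv\<^bsub>F n\<^esub> edge_gen (p (n + 1))"
  unfolding sym_rep_def using assms(2) by (intro free_endo_gen sym_rep_image_closed p)

lemma sym_rep_group_hom: "p permutes {1..n + 1} \<Longrightarrow> group_hom (F n) (F n) (sym_rep p)"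
  unfolding sym_rep_def by unfold_locales (intro free_endo_hom sym_rep_image_closed)

text \<open>The formula persists for \<open>k = n + 1\<close>, where both sides are trivial; this
  lets \<open>sym_rep_comp\<close> avoid a case distinction.\<close>

lemma sym_rep_edge_gen:
  assumes p: "p permutes {1..n + 1}" and k: "k \<in> {1..n + 1}"
  shows "sym_rep p (edge_gen k) = edge_gen (p k) \<otimes>\<^bsub>F n\<^esub> inv\<^bsub>F n\<^esub> edge_gen (p (n + 1))"
proof (cases "k = n + 1")
  case True
  have "p (n + 1) \<in> {1..n + 1}" using permutes_in_image[OF p] by simp
  then have "edge_gen (p (n + 1)) \<in> carrier (F n)" by (rule edge_gen_closed)
  then show ?thesis
    using True group_hom.hom_one[OF sym_rep_group_hom[OF p]] by (simp add: edge_gen_def)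
next
  case False
  then obtain i where "k = Suc i" "i < n" using k by (cases k) auto
  then show ?thesis using sym_rep_gen[OF p] by simp
qed

lemma sym_rep_comp:
  assumes p: "p permutes {1..n + 1}" and q: "q permutes {1..n + 1}" and i: "i < n"
  shows "sym_rep p (sym_rep q (free_gen i)) = sym_rep (p \<circ> q) (free_gen i)"
proof -
  interpret p: group_hom "F n" "F n" "sym_rep p" by (rule sym_rep_group_hom) fact
  have q_in: "q (Suc i) \<in> {1..n + 1}" "q (n + 1) \<in> {1..n + 1}"
    using i permutes_in_image[OF q] by auto
  then have pq_in: "p (q (Suc i)) \<in> {1..n + 1}" "p (q (n + 1)) \<in> {1..n + 1}" "p (n + 1) \<in> {1..n + 1}"
    using permutes_in_image[OF p] by auto
  note closed = q_in[THEN edge_gen_closed] pq_in[THEN edge_gen_closed]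
  have "sym_rep p (sym_rep q (free_gen i))
      = (edge_gen (p (q (Suc i))) \<otimes>\<^bsub>F n\<^esub> inv\<^bsub>F n\<^esub> edge_gen (p (n + 1)))
        \<otimes>\<^bsub>F n\<^esub> inv\<^bsub>F n\<^esub> (edge_gen (p (q (n + 1))) \<otimes>\<^bsub>F n\<^esub> inv\<^bsub>F n\<^esub> edge_gen (p (n + 1)))"
    using sym_rep_gen[OF q i] closed sym_rep_edge_gen[OF p q_in(1)] sym_rep_edge_gen[OF p q_in(2)]
    by (simp del: Suc_eq_plus1 add_Suc_right)
  \<comment> \<open>The two factors belonging to \<open>p (n + 1)\<close> cancel.\<close>
  also have "\<dots> = edge_gen (p (q (Suc i))) \<otimes>\<^bsub>F n\<^esub> inv\<^bsub>F n\<^esub> edge_gen (p (q (n + 1)))"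
    using closed by (simp add: F_simps F_inv_cancel)
  also have "\<dots> = sym_rep (p \<circ> q) (free_gen i)"
    using sym_rep_gen[OF permutes_compose[OF q p] i] by simp
  finally show ?thesis .
qed

lemma sym_rep_id: "i < n \<Longrightarrow> sym_rep id (free_gen i) = free_gen i"
  using sym_rep_gen[OF permutes_id, of i] by (simp add: edge_gen_def)

lemma sym_rep_closed:
  assumes p: "p permutes {1..n + 1}"
  shows "sym_rep p \<in> carrier (AutF n)"
proof -
  let ?q = "inv' p"
  note q = permutes_inv[OF p]
  show ?thesis
    unfolding sym_rep_def
  proof (rule free_endo_in_AutF)
    show "edge_gen (p (Suc i)) \<otimes>\<^bsub>F n\<^esub> inv\<^bsub>F n\<^esub> edge_gen (p (n + 1)) \<in> carrier (F n)"
      "edge_gen (?q (Suc i)) \<otimes>\<^bsub>F n\<^esub> inv\<^bsub>F n\<^esub> edge_gen (?q (n + 1)) \<in> carrier (F n)"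
      if "i < n" for i
      using sym_rep_image_closed[OF p that] sym_rep_image_closed[OF q that] .
    show "free_endo n (\<lambda>i. edge_gen (p (Suc i)) \<otimes>\<^bsub>F n\<^esub> inv\<^bsub>F n\<^esub> edge_gen (p (n + 1)))
        (edge_gen (?q (Suc i)) \<otimes>\<^bsub>F n\<^esub> inv\<^bsub>F n\<^esub> edge_gen (?q (n + 1))) = free_gen i"
      if "i < n" for i
      using sym_rep_comp[OF p q that] sym_rep_id[OF that]
      by (simp only: sym_rep_gen[OF q that] permutes_inv_o(1)[OF p]) (simp only: sym_rep_def)
    show "free_endo n (\<lambda>i. edge_gen (?q (Suc i)) \<otimes>\<^bsub>F n\<^esub> inv\<^bsub>F n\<^esub> edge_gen (?q (n + 1)))
        (edge_gen (p (Suc i)) \<otimes>\<^bsub>F n\<^esub> inv\<^bsub>F n\<^esub> edge_gen (p (n + 1))) = free_gen i"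
      if "i < n" for i
      using sym_rep_comp[OF q p that] sym_rep_id[OF that]
      by (simp only: sym_rep_gen[OF p that] permutes_inv_o(2)[OF p]) (simp only: sym_rep_def)
  qed
qed

lemma sym_rep_hom: "sym_rep \<in> hom (sym_group (n + 1)) (AutF n)"
proof (rule homI)
  fix p q assume "p \<in> carrier (sym_group (n + 1))" "q \<in> carrier (sym_group (n + 1))"
  then have p: "p permutes {1..n + 1}" and q: "q permutes {1..n + 1}"
    by (simp_all only: sym_group_carrier)
  note closed = sym_rep_closed[OF p] sym_rep_closed[OF q] sym_rep_closed[OF permutes_compose[OF q p]]
  show "sym_rep (p \<otimes>\<^bsub>sym_group (n + 1)\<^esub> q) = sym_rep p \<otimes>\<^bsub>AutF n\<^esub> sym_rep q"
    unfolding sym_group_mult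
    by (rule AutF_eqI[OF A.m_closed[OF closed(1,2)] closed(3), symmetric])
      (simp only: AutF_comp[OF closed(1,2) free_gen_closed] sym_rep_comp[OF p q])
qed (simp only: sym_rep_closed sym_group_carrier)

text \<open>Exchanging the edges \<open>Suc k\<close> and \<open>n + 1\<close> inverts generator
  \<open>k\<close>, so \<open>d\<close> conjugates \<open>transvection n i k\<close> to the inverse
  of \<open>transvection n j k\<close>. Keeping the left factor shows the product of both
  transvections as a conjugate of \<open>d\<close> times the inverse of \<open>d\<close>.\<close>

lemma double_transposition_relation:
  assumes "i < n" "j < n" "k < n" "i \<noteq> j" "i \<noteq> k" "j \<noteq> k"
  defines "d \<equiv> sym_rep (transpose (Suc i) (Suc j) \<circ> transpose (Suc k) (n + 1))"
  shows "d \<in> carrier (AutF n)"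
    and "transvection n i k \<otimes>\<^bsub>AutF n\<^esub> d
       = transvection n i k \<otimes>\<^bsub>AutF n\<^esub> transvection n j k \<otimes>\<^bsub>AutF n\<^esub> d \<otimes>\<^bsub>AutF n\<^esub> transvection n i k"
proof -
  have p: "transpose (Suc i) (Suc j) \<circ> transpose (Suc k) (n + 1) permutes {1..n + 1}"
    using assms by (intro permutes_compose permutes_swap_id) auto
  show d: "d \<in> carrier (AutF n)"
    unfolding d_def by (rule sym_rep_closed[OF p])
  \<comment> \<open>The trailing inverse of generator \<open>k\<close> arises because
    \<open>n + 1\<close> is sent to \<open>Suc k\<close>; for \<open>l = k\<close> the first factor
    is the trivial loop.\<close>
  have d_gen: "d (free_gen l) = (if l = i then free_gen j \<otimes>\<^bsub>F n\<^esub> inv\<^bsub>F n\<^esub> free_gen k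
      else if l = j then free_gen i \<otimes>\<^bsub>F n\<^esub> inv\<^bsub>F n\<^esub> free_gen k
      else if l = k then inv\<^bsub>F n\<^esub> free_gen k
      else free_gen l \<otimes>\<^bsub>F n\<^esub> inv\<^bsub>F n\<^esub> free_gen k)" if "l < n" for l
    using that assms(1-6) unfolding d_def sym_rep_gen[OF p that]
    by (auto simp: transpose_def edge_gen_def)
  note d_simps = AutF_mult[OF d] AutF_inv[OF d] AutF_closed[OF d] d_gen
  show "transvection n i k \<otimes>\<^bsub>AutF n\<^esub> d
       = transvection n i k \<otimes>\<^bsub>AutF n\<^esub> transvection n j k \<otimes>\<^bsub>AutF n\<^esub> d \<otimes>\<^bsub>AutF n\<^esub> transvection n i k"
    by (rule AutF_eqI) (use assms(1-6) d in \<open>auto simp: d_simps F_simps\<close>)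
qed

section \<open>Collapse of the image\<close>

text \<open>The relation above makes the images of \<open>transvection j k\<close> and \<open>transvection i k\<close> inverse to
  each other, and then the commutator relation kills the former.\<close>

lemma transvection_trivial:
  assumes h: "group_hom (AutF n) G h" and jk: "j < n" "k < n" "j \<noteq> k" and "3 \<le> n"
    and trivial: "\<And>i. \<lbrakk>i < n; i \<noteq> j; i \<noteq> k\<rbrakk>
      \<Longrightarrow> h (sym_rep (transpose (Suc i) (Suc j) \<circ> transpose (Suc k) (n + 1))) = \<one>\<^bsub>G\<^esub>"
  shows "h (transvection n j k) = \<one>\<^bsub>G\<^esub>"
proof -
  interpret h: group_hom "AutF n" G h by fact
  \<comment> \<open>Three generators leave an index besides \<open>j\<close> and
    \<open>k\<close>.\<close>
  have "\<exists>i\<in>{0, 1, 2}. i \<noteq> j \<and> i \<noteq> k" by auto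
  then obtain i where "i \<in> {0, 1, 2}" and ij: "i \<noteq> j" "i \<noteq> k" by blast
  then have "i < n" using \<open>3 \<le> n\<close> by auto
  note i = this ij
  let ?R = "transvection n"
  have R: "?R i k \<in> carrier (AutF n)" "?R j k \<in> carrier (AutF n)" "?R i j \<in> carrier (AutF n)"
    using i jk by auto
  note hR = R[THEN h.hom_closed]
  have "h (?R i k) = h (?R i k) \<otimes>\<^bsub>G\<^esub> h (?R j k) \<otimes>\<^bsub>G\<^esub> h (?R i k)"
    using arg_cong[where f = h, OF double_transposition_relation(2)[of i j k]]
      double_transposition_relation(1)[of i j k] trivial[OF i] i jk R hR
    by simp
  then have "h (?R j k) \<otimes>\<^bsub>G\<^esub> h (?R i k) = \<one>\<^bsub>G\<^esub>"
    using hR by (metis h.H.l_cancel_one' h.H.m_assoc h.H.m_closed)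
  moreover have "h (?R j k) \<otimes>\<^bsub>G\<^esub> h (?R i j) = h (?R i j) \<otimes>\<^bsub>G\<^esub> h (?R j k) \<otimes>\<^bsub>G\<^esub> h (?R i k)"
    using arg_cong[where f = h, OF transvection_commutator[of i n j k]] i jk R by simp
  ultimately have "h (?R j k) \<otimes>\<^bsub>G\<^esub> h (?R i j) = h (?R i j)"
    using hR by (simp add: h.H.m_assoc)
  then show ?thesis
    using hR by (metis h.H.r_cancel_one)
qed

text \<open>Modulo transvections a quarter turn is trivial, hence so is its square, a product of two
  inversions. So all inversions share one image \<open>g\<close> with trivial square, and the
  generators land in the subgroup formed by the identity and \<open>g\<close>.\<close>

lemma card_image_le_2:
  assumes h: "group_hom (AutF n) G h" and n: "0 < n"
    and trivial: "\<And>i j. \<lbrakk>i < n; j < n; i \<noteq> j\<rbrakk> \<Longrightarrow> h (transvection n i j) = \<one>\<^bsub>G\<^esub>"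
  shows "finite (h ` carrier (AutF n)) \<and> card (h ` carrier (AutF n)) \<le> 2"
proof -
  interpret h: group_hom "AutF n" G h by fact
  have sq: "h (inversion n i) \<otimes>\<^bsub>G\<^esub> h (inversion n i) = \<one>\<^bsub>G\<^esub>" if "i < n" for i
    using arg_cong[where f = h, OF inversion_inversion[OF that]] that by simp
  have left: "h (left_transvection n i j) = \<one>\<^bsub>G\<^esub>" if "i < n" "j < n" "i \<noteq> j" for i j
    using that sq[of i] trivial[of i j] by (simp add: left_transvection_def)
  have turn: "h (quarter_turn n i j) = \<one>\<^bsub>G\<^esub>" if "i < n" "j < n" "i \<noteq> j" for i j
    using arg_cong[where f = h, OF quarter_turn_eq[OF that]] that left[of i j] left[of j i] trivial[of i j]
    by simp
  have "h (inversion n i) \<otimes>\<^bsub>G\<^esub> h (inversion n j) = \<one>\<^bsub>G\<^esub>" if "i < n" "j < n" "i \<noteq> j" for i j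
    using arg_cong[where f = h, OF quarter_turn_quarter_turn[OF that]] that turn[OF that] by simp
  then have same: "h (inversion n i) = h (inversion n 0)" if "i < n" for i
    using that n sq[of 0] by (metis h.H.right_cancel h.hom_closed inversion_closed)
  define g where "g = h (inversion n 0)"
  have g: "g \<in> carrier G" "g \<otimes>\<^bsub>G\<^esub> g = \<one>\<^bsub>G\<^esub>"
    using n sq by (simp_all add: g_def)
  have sub: "subgroup {\<one>\<^bsub>G\<^esub>, g} G"
    using g h.H.inv_equality[OF g(2)] by (intro h.H.subgroupI) auto
  have "h ` carrier (AutF n) = generate G (h ` nielsen_gens n)"
    using h.generate_img[OF nielsen_gens_subset] AutF_generated by simp
  also have "\<dots> \<subseteq> {\<one>\<^bsub>G\<^esub>, g}"
    using same trivial by (intro h.H.generate_subgroup_incl sub) (auto simp: nielsen_gens_def g_def)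
  finally have "h ` carrier (AutF n) \<subseteq> {\<one>\<^bsub>G\<^esub>, g}" .
  then show ?thesis
    using card_mono[of "{\<one>\<^bsub>G\<^esub>, g}" "h ` carrier (AutF n)"] card_insert_le_m1[of 2 "{g}" "\<one>\<^bsub>G\<^esub>"]
    by (auto intro: finite_subset)
qed

end

theorem theoremB:
  fixes n :: nat and G :: "('a, 'b) monoid_scheme"
  assumes "n \<ge> 3"
    and "group G"
    and "\<not> (\<exists>H. subgroup H G \<and> G\<lparr>carrier := H\<rparr> \<cong> sym_group (n + 1))"
  shows "\<forall>h \<in> hom (AutoGroup (free_group n)) G.
           finite (h ` carrier (AutoGroup (free_group n))) \<and>
           card (h ` carrier (AutoGroup (free_group n))) \<le> 2"
proof
  fix h assume h: "h \<in> hom (AutoGroup (free_group n)) G"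
  interpret G: group G by fact
  interpret S: group "sym_group (n + 1)" by (rule sym_group_is_group)
  interpret h: group_hom "AutF n" G h
    using group.AutoGroup[OF free_group_is_group] h
    by (intro group_hom.intro group_hom_axioms.intro) simp_all
  let ?r = "\<lambda>p. h (sym_rep n p)"
  have "?r \<in> hom (sym_group (n + 1)) G"
    using hom_compose[OF sym_rep_hom h] by (simp add: comp_def)
  then interpret r: group_hom "sym_group (n + 1)" G ?r
    by unfold_locales
  \<comment> \<open>An injective restriction would embed the symmetric group in
    \<open>G\<close>.\<close>
  have "\<not> inj_on ?r (carrier (sym_group (n + 1)))"
  proof
    assume inj: "inj_on ?r (carrier (sym_group (n + 1)))"
    let ?H = "?r ` carrier (sym_group (n + 1))"
    have "?r \<in> iso (sym_group (n + 1)) (G\<lparr>carrier := ?H\<rparr>)"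
      using inj r.homh by (auto simp: iso_def hom_def bij_betw_def)
    then have "G\<lparr>carrier := ?H\<rparr> \<cong> sym_group (n + 1)"
      by (intro S.iso_sym is_isoI)
    with r.img_is_subgroup assms(3) show False by blast
  qed
  then obtain p where p: "p \<in> carrier (sym_group (n + 1))" "?r p = \<one>\<^bsub>G\<^esub>" "p \<noteq> id"
    unfolding r.inj_on_one_iff sym_group_one by blast
  \<comment> \<open>As \<open>n + 1\<close> is at least 4, the nontrivial kernel of the restriction
    contains every double transposition.\<close>
  have "?r (transpose (Suc i) (Suc j) \<circ> transpose (Suc k) (n + 1)) = \<one>\<^bsub>G\<^esub>"
    if "i < n" "j < n" "k < n" "i \<noteq> j" "i \<noteq> k" "j \<noteq> k" for i j k
    using normal_sym_group_double_transposition[OF r.normal_kernel, of p "Suc i" "Suc j" "Suc k" "n + 1"]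
      p that assms(1) by (simp add: kernel_def)
  then have "h (transvection n j k) = \<one>\<^bsub>G\<^esub>" if "j < n" "k < n" "j \<noteq> k" for j k
    using that assms(1) by (intro transvection_trivial[OF h.group_hom_axioms]) simp_all
  then show "finite (h ` carrier (AutF n)) \<and> card (h ` carrier (AutF n)) \<le> 2"
    using assms(1) by (intro card_image_le_2[OF h.group_hom_axioms]) simp_all
qed
end
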